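(* Let $aj^2+bjk+ck^2$ be a positive definite binary quadratic form with real coefficients and discriminant $d:=b^2-4ac<0$, and let $$G_n:=\sum_{j,k=1}^{n-1}\Big(\frac1{aj^2-bjk+ck^2}+\frac1{aj^2+bjk+ck^2}\Big).$$ As $n\to\infty$, $$\begin{aligned} G_n={}&\frac{2\pi}{\sqrt{|d|}}\log n+\bigg[\frac{2\pi}{\sqrt{|d|}}\gamma-\frac{\pi^2}{6}\Big(\frac1a+\frac1c\Big)-\frac{4\pi}{\sqrt{|d|}}\log|\eta(\mu)|\\ &\qquad+\frac1{\sqrt{|d|}}\Big(\Big(\frac\pi2-\arctan\Big(\frac{c-a}{\sqrt{|d|}}\Big)\Big)\log\Big(\frac ca\Big)-C(a,b,c)\Big)\bigg]\\ &+\Big[\frac1a+\frac1c-\frac{\pi}{\sqrt{|d|}}\Big]\frac1n+\Big[\frac12\Big(\frac1a+\frac1c\Big)+\frac1{12}\Big(\frac1{a-b+c}+\frac1{a+b+c}\Big)-\frac{\pi}{6\sqrt{|d|}}\Big]\frac1{n^2}\\ &+\Big[\frac16\Big(\frac1a+\frac1c\Big)+\frac1{12}\Big(\frac1{a-b+c}+\frac1{a+b+c}\Big)\Big]\frac1{n^3}+\mathcal O\Big(\frac{\log n}{n^4}\Big), \end{aligned}$$ where $$\mu=\frac{-b+\sqrt{|d|}\,i}{2c}$$ and $$\begin{aligned}C(a,b,c)={}&\mathrm{Cl}_2\Big(\pi-2\arctan\Big(\frac{2a-b}{\sqrt{|d|}}\Big)\Big)+\mathrm{Cl}_2\Big(\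pi-2\arctan\Big(\frac{2a+b}{\sqrt{|d|}}\Big)\Big)\\&+\mathrm{Cl}_2\Big(\pi-2\arctan\Big(\frac{2c-b}{\sqrt{|d|}}\Big)\Big)+\mathrm{Cl}_2\Big(\pi-2\arctan\Big(\frac{2c+b}{\sqrt{|d|}}\Big)\Big).\end{aligned}$$
   Context: $\gamma$ is Euler's constant. $\eta$ is the Dedekind eta-function, $\eta(\tau)=e^{\pi i\tau/12}\prod_{k=1}^\infty(1-e^{2\pi ik\tau})$ for $\Im\tau>0$. $\mathrm{Cl}_2$ is the Clausen function, $\mathrm{Cl}_2(\theta)=\sum_{k=1}^\infty\frac{\sin k\theta}{k^2}$. The coefficients $a,b,c$ are fixed and the implied constant may depend on them. *)

theory Defs
  imports "HOL-Analysis.Analysis" "HOL-Library.Landau_Symbols"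
begin

definition bqf :: "real \<Rightarrow> real \<Rightarrow> real \<Rightarrow> real \<Rightarrow> real \<Rightarrow> real" where
  "bqf a b c x y = a * x\<^sup>2 + b * x * y + c * y\<^sup>2"

definition bqf_pos_def :: "real \<Rightarrow> real \<Rightarrow> real \<Rightarrow> bool" where
  "bqf_pos_def a b c \<longleftrightarrow> (\<forall>x y. (x, y) \<noteq> (0, 0) \<longrightarrow> bqf a b c x y > 0)"

definition bqf_disc :: "real \<Rightarrow> real \<Rightarrow> real \<Rightarrow> real" where
  "bqf_disc a b c = b\<^sup>2 - 4 * a * c"

lemma bqf_pos_def_disc_neg:
  assumes "bqf_pos_def a b c"
  shows "bqf_disc a b c < 0"
proof -
  have "bqf a b c 1 0 > 0" and "bqf a b c (- b) (2 * a) > 0 \<or> a = 0"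
    using assms unfolding bqf_pos_def_def by (auto simp del: One_nat_def)
  then have a: "a > 0" and "bqf a b c (- b) (2 * a) > 0"
    by (auto simp: bqf_def)
  moreover have "bqf a b c (- b) (2 * a) = a * (- bqf_disc a b c)"
    by (simp add: bqf_def bqf_disc_def power2_eq_square algebra_simps)
  ultimately show ?thesis
    by (simp add: mult_less_0_iff)
qed

(* The meaningful domain is Im t > 0, where the product converges. *)
definition dedekind_eta :: "complex \<Rightarrow> complex" where
  "dedekind_eta t = exp (of_real pi * \<i> * t / 12) *
     (\<Prod>k. 1 - exp (2 * of_real pi * \<i> * of_nat (Suc k) * t))"

definition clausen2 :: "real \<Rightarrow> real" where
  "clausen2 \<theta> = (\<Sum>k. sin (real (Suc k) * \<theta>) / (real (Suc k))\<^sup>2)"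

definition bqf_sum :: "real \<Rightarrow> real \<Rightarrow> real \<Rightarrow> nat \<Rightarrow> real" where
  "bqf_sum a b c n = (\<Sum>j = 1..n - 1. \<Sum>k = 1..n - 1.
     1 / (a * (real j)\<^sup>2 - b * real j * real k + c * (real k)\<^sup>2) +
     1 / (a * (real j)\<^sup>2 + b * real j * real k + c * (real k)\<^sup>2))"

definition bqf_mu :: "real \<Rightarrow> real \<Rightarrow> real \<Rightarrow> complex" where
  "bqf_mu a b c = (- of_real b + of_real (sqrt \<bar>bqf_disc a b c\<bar>) * \<i>) / (2 * of_real c)"

definition bqf_clausen :: "real \<Rightarrow> real \<Rightarrow> real \<Rightarrow> real" where
  "bqf_clausen a b c = (let s = sqrt \<bar>bqf_disc a b c\<bar> in
     clausen2 (pi - 2 * arctan ((2 * a - b) / s)) +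
     clausen2 (pi - 2 * arctan ((2 * a + b) / s)) +
     clausen2 (pi - 2 * arctan ((2 * c - b) / s)) +
     clausen2 (pi - 2 * arctan ((2 * c + b) / s)))"

end

(* The double sum over 1 \<le> j, k < n is split as (all k \<ge> 1) minus (k \<ge> n). The complete rows are
   evaluated by the partial fractions of the cotangent and summed over j to log n, Euler's constant and
   a Lambert series, which is the logarithm of the eta product. The truncated part is a Riemann sum
   whose limit has an explicit primitive in terms of Cl_2, because the logarithm integrated against
   the inverse quadratic form becomes log (sin / cos) after an arctan substitution. This gives the
   constant term. For the remaining terms, the increment from n to n + 1 consists of two
   edges of the square, on each of which Euler-Maclaurin has error O(n^-5); summing the increments
   from n to infinity yields the expansion, even with error O(n^-4). *)
theory Submission
  imports Defs "HOL-Real_Asymp.Real_Asymp"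
begin

section \<open>The Clausen function\<close>

text \<open>Only k runs to infinity in the rows, so the split treats a and c unequally, and the
  symmetry of the answer has to be recovered. The cotangent expansion includes k = 0; removing this
  term costs 1/(a j^2) in each row, hence pi^2/(6 a) in total, and the matching term in c appears
  when the eta product is completed by its factor e^(pi i \<mu>/12). In the truncated part the
  addition theorem of the arctangent creates the arguments with 2 c \<plusminus> b beside those with
  2 a \<plusminus> b. The delicate analytic point is the derivative of Cl_2: differentiating
  termwise gives the sum of cos (k x)/k, which has no summable majorant. The differentiation is
  therefore carried out on Abel means, and the limit r \<rightarrow> 1 is taken locally uniformly
  inside (0, 2 pi). The row computation gives no rate, because its Riemann sum is only shown to
  converge. Increments in n avoid this: neither eta nor Cl_2 occurs in them, and they determine
  every term but the constant.\<close>

lemma clausen2_sums: "(\<lambda>k. sin (real (Suc k) * x) / (real (Suc k))\<^sup>2) sums clausen2 x"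
proof -
  have "summable (\<lambda>k. sin (real (Suc k) * x) / (real (Suc k))\<^sup>2)"
  proof (rule summable_comparison_test')
    show "summable (\<lambda>k. 1 / (real (Suc k))\<^sup>2)"
      using inverse_squares_sums by (simp add: sums_iff add_ac)
    show "norm (sin (real (Suc k) * x) / (real (Suc k))\<^sup>2) \<le> 1 / (real (Suc k))\<^sup>2" if "k \<ge> 0" for k
      by (simp add: divide_right_mono del: of_nat_Suc)
  qed
  thus ?thesis
    unfolding clausen2_def by (rule summable_sums)
qed

lemma continuous_on_clausen2: "continuous_on UNIV clausen2"
proof -
  have "uniform_limit UNIV (\<lambda>n x. \<Sum>k<n. sin (real (Suc k) * x) / (real (Suc k))\<^sup>2)
          (\<lambda>x. \<Sum>k. sin (real (Suc k) * x) / (real (Suc k))\<^sup>2) sequentially"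
  proof (rule Weierstrass_m_test)
    show "summable (\<lambda>k. 1 / (real (Suc k))\<^sup>2)"
      using inverse_squares_sums by (simp add: sums_iff add_ac)
    show "norm (sin (real (Suc k) * x) / (real (Suc k))\<^sup>2) \<le> 1 / (real (Suc k))\<^sup>2" for k x
      by (simp add: divide_right_mono del: of_nat_Suc)
  qed
  hence "continuous_on UNIV (\<lambda>x. \<Sum>k. sin (real (Suc k) * x) / (real (Suc k))\<^sup>2)"
    by (rule uniform_limit_theorem[rotated]) (auto intro!: continuous_intros always_eventually)
  thus ?thesis
    by (simp add: clausen2_def[abs_def])
qed

lemma clausen2_2pi_minus: "clausen2 (2 * pi - x) = - clausen2 x"
proof -
  have "sin (real (Suc k) * (2 * pi - x)) = - sin (real (Suc k) * x)" for k
  proof -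
    have *: "real (Suc k) * (2 * pi - x) = 2 * pi * real (Suc k) - real (Suc k) * x"
      by (simp add: algebra_simps)
    have "sin (2 * pi * real (Suc k)) = 0" "cos (2 * pi * real (Suc k)) = 1"
      by (simp_all add: sin_integer_2pi cos_integer_2pi del: of_nat_Suc)
    thus ?thesis
      by (simp only: * sin_diff mult_zero_left mult_1 diff_0)
  qed
  hence "(\<lambda>k. - (sin (real (Suc k) * x) / (real (Suc k))\<^sup>2)) sums clausen2 (2 * pi - x)"
    using clausen2_sums[of "2 * pi - x"] by simp
  thus ?thesis
    using sums_minus[OF clausen2_sums[of x]] sums_unique2 by blast
qed

text \<open>The Abel mean of the Clausen series, which is the imaginary part of Li_2 (r e^(i x)).
  For r < 1 the factor r^k gives the termwise derivative a geometric majorant.\<close>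

definition abel_clausen :: "real \<Rightarrow> real \<Rightarrow> real" where
  "abel_clausen r x = (\<Sum>k. r ^ Suc k * sin (real (Suc k) * x) / (real (Suc k))\<^sup>2)"

text \<open>The majorant 1/k^2 does not depend on r in [0, 1], so the series is continuous in r up
  to the end point 1.\<close>

lemma abel_clausen_tendsto:
  assumes "r \<longlonglongrightarrow> 1" "\<And>n. 0 \<le> r n" "\<And>n. r n \<le> 1"
  shows "(\<lambda>n. abel_clausen (r n) x) \<longlonglongrightarrow> clausen2 x"
proof -
  have "uniform_limit {0..1} (\<lambda>n r. \<Sum>k<n. r ^ Suc k * sin (real (Suc k) * x) / (real (Suc k))\<^sup>2)
          (\<lambda>r. \<Sum>k. r ^ Suc k * sin (real (Suc k) * x) / (real (Suc k))\<^sup>2) sequentially"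
  proof (rule Weierstrass_m_test)
    show "summable (\<lambda>k. 1 / (real (Suc k))\<^sup>2)"
      using inverse_squares_sums by (simp add: sums_iff add_ac)
    show "norm (r ^ Suc k * sin (real (Suc k) * x) / (real (Suc k))\<^sup>2) \<le> 1 / (real (Suc k))\<^sup>2"
      if "r \<in> {0..1}" for k and r :: real
    proof -
      have "r ^ Suc k * \<bar>sin (real (Suc k) * x)\<bar> \<le> 1 * 1"
        using that by (intro mult_mono power_le_one) auto
      thus ?thesis
        using that by (simp add: abs_mult divide_right_mono del: of_nat_Suc)
    qed
  qed
  hence "continuous_on {0..1} (\<lambda>r. abel_clausen r x)"
    unfolding abel_clausen_def
    by (rule uniform_limit_theorem[rotated]) (auto intro!: continuous_intros always_eventually)
  hence "(\<lambda>n. abel_clausen (r n) x) \<longlonglongrightarrow> abel_clausen 1 x"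
    by (rule continuous_on_tendsto_compose) (use assms in \<open>auto intro!: always_eventually\<close>)
  thus ?thesis
    by (simp add: abel_clausen_def clausen2_def)
qed

text \<open>The differentiated series, the sum of r^k cos (k x) / k, is the real part of -Ln (1 - r
  e^(i x)).\<close>

lemma abel_clausen_deriv:
  assumes "0 \<le> r" "r < 1"
  shows "(abel_clausen r has_field_derivative - ln (cmod (1 - r * cis x))) (at x)"
proof -
  have conv: "uniformly_convergent_on UNIV (\<lambda>n x. \<Sum>k<n. r ^ Suc k * cos (real (Suc k) * x) / real (Suc k))"
  proof (rule Weierstrass_m_test')
    show "summable (\<lambda>k. r ^ Suc k)"
      using assms by (simp add: summable_mult summable_geometric)
    show "norm (r ^ Suc k * cos (real (Suc k) * x) / real (Suc k)) \<le> r ^ Suc k" for k x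
    proof -
      have "r ^ Suc k * \<bar>cos (real (Suc k) * x)\<bar> / real (Suc k) \<le> r ^ Suc k * 1 / 1"
        using assms by (intro frac_le mult_mono) auto
      thus ?thesis
        using assms by (simp add: abs_mult)
    qed
  qed
  have "((\<lambda>x. \<Sum>k. r ^ Suc k * sin (real (Suc k) * x) / (real (Suc k))\<^sup>2) has_field_derivative
      (\<Sum>k. r ^ Suc k * cos (real (Suc k) * x) / real (Suc k))) (at x)"
  proof (rule has_field_derivative_series'(2)[OF convex_UNIV _ conv, of _ 0])
    fix n :: nat and y :: real
    show "((\<lambda>x. r ^ Suc n * sin (real (Suc n) * x) / (real (Suc n))\<^sup>2) has_field_derivative
        r ^ Suc n * cos (real (Suc n) * y) / real (Suc n)) (at y)"
      by (auto intro!: derivative_eq_intros simp: power2_eq_square simp del: of_nat_Suc)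
  qed auto
  moreover have "(\<lambda>k. r ^ Suc k * cos (real (Suc k) * x) / real (Suc k)) sums
      (- ln (cmod (1 - r * cis x)))"
  proof -
    let ?z = "r * cis x"
    have z: "cmod ?z < 1" using assms by (simp add: norm_mult)
    hence nz: "1 - ?z \<noteq> 0" by auto
    have "(\<lambda>n. - (?z ^ n) / of_nat n) sums ln (1 - ?z)"
      using Ln_series'[of "- ?z"] z by simp
    \<comment> \<open>The term at n = 0 is a division by zero, hence 0, so the shift of the index
      leaves the sum unchanged.\<close>
    hence "(\<lambda>n. - (?z ^ Suc n) / of_nat (Suc n)) sums ln (1 - ?z)"
      by (subst sums_Suc_iff) simp
    from sums_minus[OF sums_Re[OF this]]
    have "(\<lambda>n. - Re (- (?z ^ Suc n) / of_nat (Suc n))) sums (- ln (cmod (1 - ?z)))"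
      using nz by simp
    also have "(\<lambda>n. - Re (- (?z ^ Suc n) / of_nat (Suc n))) =
        (\<lambda>k. r ^ Suc k * cos (real (Suc k) * x) / real (Suc k))"
    proof
      fix n
      have "- (?z ^ Suc n) / of_nat (Suc n) = complex_of_real (- (r ^ Suc n) / real (Suc n)) * cis (real (Suc n) * x)"
        using Complex.DeMoivre[of x "Suc n"] by (simp add: power_mult_distrib del: of_nat_Suc power_Suc)
      thus "- Re (- (?z ^ Suc n) / of_nat (Suc n)) = r ^ Suc n * cos (real (Suc n) * x) / real (Suc n)"
        by (simp del: of_nat_Suc power_Suc)
    qed
    finally show ?thesis .
  qed
  ultimately show ?thesis
    unfolding abel_clausen_def[abs_def] by (simp add: sums_iff)
qed

lemma cmod_1_minus_cis:
  assumes "0 < x" "x < 2 * pi"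
  shows "cmod (1 - cis x) = 2 * sin (x / 2)"
proof -
  have pos: "sin (x / 2) > 0" using assms by (intro sin_gt_zero) auto
  have "(cmod (1 - cis x))\<^sup>2 = (2 * sin (x / 2))\<^sup>2"
    using cos_double_sin[of "x/2"] sin_cos_squared_add[of x]
    unfolding cmod_power2 by (simp add: power2_eq_square algebra_simps)
  thus ?thesis by (rule power2_eq_imp_eq) (use pos in auto)
qed

text \<open>The derivatives of the Abel means converge uniformly on compact intervals inside (0, 2
  pi), so limit and derivative may be interchanged; the limit derivative is -ln |1 - e^(i
  x)|.\<close>

lemma has_field_derivative_clausen2:
  assumes "0 < x" "x < 2 * pi"
  shows "(clausen2 has_field_derivative - ln (2 * sin (x / 2))) (at x)"
proof -
  \<comment> \<open>The midpoints of [0, x] and [x, 2 pi]: between them 1 - cis y keeps away from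
    its zeros 0 and 2 pi.\<close>
  define l u where "l = x / 2" and "u = (x + 2 * pi) / 2"
  have lu: "0 < l" "l < x" "x < u" "u < 2 * pi"
    using assms by (auto simp: l_def u_def)
  define r where "r = (\<lambda>n::nat. 1 - 1 / real (Suc n))"
  have r: "0 \<le> r n" "r n < 1" for n by (auto simp: r_def divide_simps)
  have r_lim: "r \<longlonglongrightarrow> 1"
    unfolding r_def using tendsto_diff[OF tendsto_const[of 1] LIMSEQ_inverse_real_of_nat]
    by (simp add: inverse_eq_divide del: of_nat_Suc)
  have nz: "1 - of_real r * cis y \<noteq> 0" if "0 \<le> r" "r \<le> 1" "l \<le> y" "y \<le> u" for r y :: real
  proof
    assume "1 - of_real r * cis y = 0"
    hence eq: "of_real r * cis y = 1" by simp
    hence "cmod (of_real r * cis y) = 1" by simp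
    hence "r = 1" using that by (simp add: norm_mult)
    with eq have "cmod (1 - cis y) = 0" by simp
    moreover have "cmod (1 - cis y) = 2 * sin (y / 2)"
      using that lu by (intro cmod_1_minus_cis) auto
    moreover have "sin (y / 2) > 0" using that lu by (intro sin_gt_zero) auto
    ultimately show False by simp
  qed
  let ?h = "\<lambda>p::real\<times>real. ln (cmod (1 - of_real (fst p) * cis (snd p)))"
  have "continuous_on ({0..1} \<times> {l..u}) ?h"
    by (intro continuous_intros) (use nz in auto)
  \<comment> \<open>Uniform continuity on the compact rectangle turns \<open>r n\<close>
    \<rightarrow> 1 into convergence of the derivatives that is uniform in y.\<close>
  hence "uniformly_continuous_on ({0..1} \<times> {l..u}) ?h"
    by (rule compact_uniformly_continuous) (intro compact_Times compact_Icc)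
  note uc = this[unfolded uniformly_continuous_on_def, rule_format]
  have "\<exists>g. \<forall>y\<in>{l..u}. (\<lambda>n. abel_clausen (r n) y) \<longlonglongrightarrow> g y \<and>
     (g has_derivative (\<lambda>h. - ln (cmod (1 - cis y)) * h)) (at y within {l..u})"
  proof (rule has_derivative_sequence[where f' = "\<lambda>n y h. - ln (cmod (1 - of_real (r n) * cis y)) * h"])
    show "x \<in> {l..u}" "convex {l..u}" using lu by auto
    show "(\<lambda>n. abel_clausen (r n) x) \<longlonglongrightarrow> clausen2 x"
      by (rule abel_clausen_tendsto[OF r_lim r(1) less_imp_le[OF r(2)]])
    show "(abel_clausen (r n) has_derivative (\<lambda>h. - ln (cmod (1 - of_real (r n) * cis y)) * h)) (at y within {l..u})"
      for n y
      using abel_clausen_deriv[OF r[of n], of y]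
      unfolding has_field_derivative_def by (rule has_derivative_at_withinI)
    fix e :: real assume "e > 0"
    from uc[OF this] obtain d where d: "d > 0"
      "\<And>p q. p \<in> {0..1} \<times> {l..u} \<Longrightarrow> q \<in> {0..1} \<times> {l..u} \<Longrightarrow> dist q p < d \<Longrightarrow> dist (?h q) (?h p) < e"
      by metis
    have "eventually (\<lambda>n. dist (r n) 1 < d) sequentially"
      using r_lim d(1) by (rule tendstoD)
    thus "\<forall>\<^sub>F n in sequentially. \<forall>y\<in>{l..u}. \<forall>h.
        norm (- ln (cmod (1 - of_real (r n) * cis y)) * h - - ln (cmod (1 - cis y)) * h) \<le> e * norm h"
    proof (eventually_elim, intro ballI allI)
      fix n y h assume n: "dist (r n) 1 < d" and y: "y \<in> {l..u}"
      have "dist (?h (r n, y)) (?h (1, y)) < e"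
        using n y r[of n] by (intro d(2)) (auto simp: dist_Pair_Pair)
      hence "\<bar>- ln (cmod (1 - of_real (r n) * cis y)) - - ln (cmod (1 - cis y))\<bar> \<le> e"
        by (simp add: dist_real_def)
      hence "\<bar>- ln (cmod (1 - of_real (r n) * cis y)) - - ln (cmod (1 - cis y))\<bar> * \<bar>h\<bar> \<le> e * \<bar>h\<bar>"
        by (rule mult_right_mono) simp
      thus "norm (- ln (cmod (1 - of_real (r n) * cis y)) * h - - ln (cmod (1 - cis y)) * h) \<le> e * norm h"
        by (simp only: real_norm_def left_diff_distrib[symmetric] abs_mult)
    qed
  qed
  then obtain g where g: "\<And>y. y \<in> {l..u} \<Longrightarrow> (\<lambda>n. abel_clausen (r n) y) \<longlonglongrightarrow> g y"
    "\<And>y. y \<in> {l..u} \<Longrightarrow> (g has_derivative (\<lambda>h. - ln (cmod (1 - cis y)) * h)) (at y within {l..u})"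
    by blast
  have geq: "g y = clausen2 y" if "y \<in> {l..u}" for y
    using LIMSEQ_unique[OF g(1)[OF that]] abel_clausen_tendsto[OF r_lim r(1) less_imp_le[OF r(2)]] by blast
  have "(g has_field_derivative - ln (cmod (1 - cis x))) (at x within {l..u})"
    unfolding has_field_derivative_def by (rule g(2)) (use lu in auto)
  hence "(g has_field_derivative - ln (cmod (1 - cis x))) (at x)"
    using lu by (simp add: at_within_Icc_at)
  hence "(clausen2 has_field_derivative - ln (cmod (1 - cis x))) (at x)"
    by (rule has_field_derivative_transform_within_open[of _ _ _ "{l<..<u}"]) (use lu geq in auto)
  thus ?thesis
    using cmod_1_minus_cis[OF assms] by simp
qed

section \<open>The limit of the truncated rows\<close>

text \<open>The difference d lies in (0, pi), so pi/2 - d lies in the range of arctan, and its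
  tangent is cot d. Working with the complement avoids a case distinction on the sign of 1 + x
  y.\<close>

lemma arctan_diff_complement:
  fixes x y :: real
  assumes "x < y"
  shows "arctan y - arctan x = pi / 2 - arctan ((1 + x * y) / (y - x))"
proof -
  define d where "d = arctan y - arctan x"
  define p where "p = cos (arctan y) * cos (arctan x)"
  have d: "0 < d" "d < pi"
    using assms arctan_lbound[of x] arctan_ubound[of y] arctan_monotone[of x y] by (auto simp: d_def)
  have p: "p > 0"
    unfolding p_def by (intro mult_pos_pos cos_gt_zero_pi arctan_lbound arctan_ubound)
  have sin: "sin (arctan t) = t * cos (arctan t)" for t :: real
    by (simp add: sin_arctan cos_arctan)
  have "cos d = p * (1 + x * y)" "sin d = p * (y - x)"
    by (simp_all add: d_def p_def cos_diff sin_diff sin algebra_simps)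
  hence "tan (pi / 2 - d) = (1 + x * y) / (y - x)"
    using p by (simp add: tan_def sin_diff cos_diff)
  hence "arctan ((1 + x * y) / (y - x)) = pi / 2 - d"
    using d by (intro arctan_unique) auto
  thus ?thesis by (simp add: d_def)
qed

text \<open>For the arguments (2 a + b)/s and (b - 2 a)/s the relation s^2 = 4 a c - b^2 reduces 1 +
  x y to 4 a (c - a)/s^2. This is the origin of the angle multiplying log (c/a) in the
  result.\<close>

lemma arctan_sum_complement:
  fixes a b c :: real
  assumes "a > 0" "b\<^sup>2 < 4 * a * c"
  defines "s \<equiv> sqrt (4 * a * c - b\<^sup>2)"
  shows "arctan ((2 * a + b) / s) + arctan ((2 * a - b) / s) = pi / 2 - arctan ((c - a) / s)"
proof -
  have s: "s > 0" "s * s = 4 * a * c - b * b" using assms by (auto simp: s_def power2_eq_square)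
  have lt: "(b - 2 * a) / s < (2 * a + b) / s"
    by (rule divide_strict_right_mono) (use s(1) \<open>a > 0\<close> in linarith)+
  have "(1 + (b - 2 * a) / s * ((2 * a + b) / s)) / ((2 * a + b) / s - (b - 2 * a) / s) = (s * s + (b * b - 4 * a * a)) / (4 * a * s)"
    using s(1) assms by (simp add: field_simps)
  also have "\<dots> = (c - a) / s" unfolding s(2) using s(1) assms by (simp add: field_simps)
  finally show ?thesis
    using arctan_diff_complement[OF lt] arctan_minus[of "(2 * a - b) / s"]
    by (simp add: minus_divide_left)
qed

section \<open>Primitives attached to a positive quadratic polynomial\<close>

lemma quadratic_pos:
  fixes a b c t :: real
  assumes "a > 0" "b\<^sup>2 < 4 * a * c"
  shows "a * t\<^sup>2 + b * t + c > 0"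
proof -
  have "4 * a * (a * t\<^sup>2 + b * t + c) = (2 * a * t + b)\<^sup>2 + (4 * a * c - b\<^sup>2)"
    by (simp add: power2_eq_square algebra_simps)
  also have "\<dots> > 0" using assms(2) by (intro add_nonneg_pos) auto
  finally show ?thesis using assms(1) by (simp add: zero_less_mult_iff)
qed

lemma has_field_derivative_arctan_quadratic:
  fixes a b c t :: real
  assumes "a > 0" "b\<^sup>2 < 4 * a * c"
  defines "s \<equiv> sqrt (4 * a * c - b\<^sup>2)"
  shows "((\<lambda>t. arctan ((2 * a * t + b) / s)) has_field_derivative
            s / 2 / (a * t\<^sup>2 + b * t + c)) (at t)"
proof -
  have s: "s > 0" "s\<^sup>2 = 4 * a * c - b\<^sup>2" using assms by (auto simp: s_def)
  define q where "q = a * t\<^sup>2 + b * t + c"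
  have q: "q > 0" unfolding q_def using quadratic_pos assms by blast
  have eq: "s\<^sup>2 + (2 * a * t + b)\<^sup>2 = 4 * a * q"
    unfolding s q_def by (simp add: power2_eq_square algebra_simps)
  have "1 + ((2 * a * t + b) / s)\<^sup>2 = (s\<^sup>2 + (2 * a * t + b)\<^sup>2) / s\<^sup>2"
    using s(1) by (simp add: field_simps power2_eq_square)
  hence "inverse (1 + ((2 * a * t + b) / s)\<^sup>2) * (2 * a / s) = s / 2 / q"
    unfolding eq using s(1) q assms(1) by (simp add: field_simps power2_eq_square)
  moreover have "((\<lambda>t. arctan ((2 * a * t + b) / s)) has_field_derivative
      inverse (1 + ((2 * a * t + b) / s)\<^sup>2) * (2 * a / s)) (at t)"
    using s(1) by (auto intro!: derivative_eq_intros simp: field_simps)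
  ultimately show ?thesis by (simp add: q_def)
qed

lemma has_field_derivative_clausen2_compose:
  assumes "(f has_field_derivative D) (at t)" "0 < f t" "f t < 2 * pi"
  shows "((\<lambda>t. clausen2 (f t)) has_field_derivative - ln (2 * sin (f t / 2)) * D) (at t)"
  by (rule DERIV_chain2[where f = clausen2, OF has_field_derivative_clausen2 assms(1)]) (fact assms)+

text \<open>With q = a t^2 + b t + c one has du = s dt / (2 q) and t = sqrt (c/a) sin (u - u0) / cos
  u. A factor 2 inserted into numerator and denominator makes both logarithms derivatives of Cl_2,
  at 2 (u - u0) and at pi - 2 u; the factor sqrt (c/a) leaves the linear term.\<close>

definition log_quadratic_primitive :: "real \<Rightarrow> real \<Rightarrow> real \<Rightarrow> real \<Rightarrow> real" where
  "log_quadratic_primitive a b c t =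
    (let s = sqrt (4 * a * c - b\<^sup>2);
         u = arctan ((2 * a * t + b) / s);
         u0 = arctan (b / s)
     in (clausen2 (2 * (u - u0)) + clausen2 (pi - 2 * u) - (u - u0) * ln (c / a)) / s)"

lemma has_field_derivative_log_quadratic_primitive:
  fixes a b c t :: real
  assumes "a > 0" "c > 0" "b\<^sup>2 < 4 * a * c" "t > 0"
  shows "(log_quadratic_primitive a b c has_field_derivative - ln t / (a * t\<^sup>2 + b * t + c)) (at t)"
proof -
  define s where "s = sqrt (4 * a * c - b\<^sup>2)"
  define u where "u = (\<lambda>t. arctan ((2 * a * t + b) / s))"
  define u0 where "u0 = arctan (b / s)"
  define q where "q = a * t\<^sup>2 + b * t + c"
  have s: "s > 0" "s\<^sup>2 = 4 * a * c - b\<^sup>2" using assms by (auto simp: s_def)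
  have q: "q > 0" unfolding q_def using quadratic_pos assms by blast
  have u': "(u has_field_derivative s / 2 / q) (at t)"
    unfolding u_def s_def q_def using assms by (intro has_field_derivative_arctan_quadratic)
  have "b / s < (2 * a * t + b) / s" using s assms by (intro divide_strict_right_mono) auto
  hence "u0 < u t" unfolding u_def u0_def by (rule arctan_monotone)
  moreover have "-(pi/2) < u0" "u t < pi/2" "-(pi/2) < u t"
    unfolding u_def u0_def using arctan_bounded by auto
  ultimately have bds: "0 < 2 * (u t - u0)" "2 * (u t - u0) < 2 * pi" "0 < pi - 2 * u t" "pi - 2 * u t < 2 * pi"
    by auto
  have sin: "sin (arctan x) = x * cos (arctan x)" for x :: real
    by (simp add: sin_arctan cos_arctan)
  have cosu: "cos (u t) > 0"
    unfolding u_def by (intro cos_gt_zero_pi arctan_lbound arctan_ubound)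
  have "(cos u0)\<^sup>2 = s\<^sup>2 / (s\<^sup>2 + b\<^sup>2)"
    unfolding u0_def cos_arctan using s(1) by (simp add: power_divide field_simps add_pos_nonneg)
  also have "s\<^sup>2 + b\<^sup>2 = 4 * a * c" using s by simp
  finally have cosu0: "(cos u0)\<^sup>2 = s\<^sup>2 / (4 * a * c)" .
  have "sin (u t - u0) = cos (u t) * cos u0 * (2 * a * t / s)"
    unfolding sin_diff u_def u0_def sin using s(1) by (simp add: field_simps)
  hence "(sin (u t - u0))\<^sup>2 = (cos (u t))\<^sup>2 * (a * t\<^sup>2 / c)"
    using assms s(1) by (simp add: power_mult_distrib power_divide cosu0) (simp add: field_simps power2_eq_square)
  \<comment> \<open>Squaring keeps the root of c / a out of the computation; the logarithm is halved
    at the end.\<close>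
  hence eq: "t\<^sup>2 = (sin (u t - u0) / cos (u t))\<^sup>2 * (c / a)"
    using cosu assms by (simp add: power_divide field_simps)
  have sinpos: "sin (u t - u0) > 0" using bds by (intro sin_gt_zero) auto
  have "2 * ln t = ln (t\<^sup>2)" using assms by (simp add: ln_realpow)
  also have "\<dots> = 2 * (ln (sin (u t - u0)) - ln (cos (u t))) + ln (c / a)"
    unfolding eq using sinpos cosu assms by (subst ln_mult_pos) (auto simp: ln_realpow ln_div)
  finally have ln_t: "2 * ln t = 2 * (ln (sin (u t - u0)) - ln (cos (u t))) + ln (c / a)" .
  have "((\<lambda>t. clausen2 (2 * (u t - u0))) has_field_derivative
      - ln (2 * sin (u t - u0)) * (s / q)) (at t)"
  proof -
    have "((\<lambda>t. clausen2 (2 * (u t - u0))) has_field_derivative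
      - ln (2 * sin (2 * (u t - u0) / 2)) * (s / q)) (at t)"
      using u' bds by (intro has_field_derivative_clausen2_compose) (auto intro!: derivative_eq_intros)
    moreover have "2 * (u t - u0) / 2 = u t - u0" by simp
    ultimately show ?thesis by (simp only:)
  qed
  moreover have "((\<lambda>t. clausen2 (pi - 2 * u t)) has_field_derivative
      ln (2 * cos (u t)) * (s / q)) (at t)"
  proof -
    have "((\<lambda>t. clausen2 (pi - 2 * u t)) has_field_derivative
      - ln (2 * sin ((pi - 2 * u t) / 2)) * (- (s / q))) (at t)"
      using u' bds by (intro has_field_derivative_clausen2_compose) (auto intro!: derivative_eq_intros)
    moreover have "sin ((pi - 2 * u t) / 2) = cos (u t)"
      by (simp add: cos_sin_eq diff_divide_distrib)
    ultimately show ?thesis by simp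
  qed
  ultimately have "((\<lambda>t. (clausen2 (2 * (u t - u0)) + clausen2 (pi - 2 * u t) - (u t - u0) * ln (c / a)) / s)
      has_field_derivative (- ln (2 * sin (u t - u0)) * (s / q) + ln (2 * cos (u t)) * (s / q)
          - s / 2 / q * ln (c / a)) / s) (at t)"
    using u' s(1) by (auto intro!: derivative_eq_intros)
  also have "(- ln (2 * sin (u t - u0)) * (s / q) + ln (2 * cos (u t)) * (s / q)
          - s / 2 / q * ln (c / a)) / s = - (2 * ln t) / (2 * q)"
    unfolding ln_t using sinpos cosu s(1) q by (simp add: ln_mult_pos field_simps)
  also have "\<dots> = - ln t / q" by simp
  finally show ?thesis
    unfolding log_quadratic_primitive_def[abs_def] Let_def u_def u0_def s_def q_def .
qed

lemma isCont_log_quadratic_primitive: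
  assumes "a > 0" "b\<^sup>2 < 4 * a * c"
  shows "isCont (log_quadratic_primitive a b c) t"
proof -
  have "isCont clausen2 x" for x
    using continuous_on_clausen2 by (simp add: continuous_on_eq_continuous_at)
  note [continuous_intros] = isCont_o2[OF _ this]
  show ?thesis
    unfolding log_quadratic_primitive_def[abs_def] Let_def using assms
    by (intro continuous_intros) auto
qed

(* By homogeneity, strip_primitive a b c (x / y) / x is the integral of the pair of inverse forms
   over the ray {x} times [y, oo). *)
definition strip_primitive :: "real \<Rightarrow> real \<Rightarrow> real \<Rightarrow> real \<Rightarrow> real" where
  "strip_primitive a b c x =
    (let s = sqrt (4 * a * c - b\<^sup>2)
     in 2 / s * (arctan ((2 * a * x + b) / s) + arctan ((2 * a * x - b) / s)))"

lemma strip_primitive_0 [simp]: "strip_primitive a b c 0 = 0"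
  by (simp add: strip_primitive_def Let_def arctan_minus)

lemma has_field_derivative_strip_primitive:
  fixes a b c t :: real
  assumes "a > 0" "b\<^sup>2 < 4 * a * c"
  shows "(strip_primitive a b c has_field_derivative
     1 / (a * t\<^sup>2 + b * t + c) + 1 / (a * t\<^sup>2 - b * t + c)) (at t)"
proof -
  define s where "s = sqrt (4 * a * c - b\<^sup>2)"
  have s: "s > 0" using assms by (simp add: s_def)
  have "((\<lambda>t. arctan ((2 * a * t + b) / s)) has_field_derivative s / 2 / (a * t\<^sup>2 + b * t + c)) (at t)"
    using has_field_derivative_arctan_quadratic[of a b c t] assms by (simp add: s_def)
  moreover have "((\<lambda>t. arctan ((2 * a * t - b) / s)) has_field_derivative s / 2 / (a * t\<^sup>2 - b * t + c)) (at t)"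
    using has_field_derivative_arctan_quadratic[of a "-b" c t] assms by (simp add: s_def)
  ultimately have "((\<lambda>t. 2 / s * (arctan ((2 * a * t + b) / s) + arctan ((2 * a * t - b) / s))) has_field_derivative
     2 / s * (s / 2 / (a * t\<^sup>2 + b * t + c) + s / 2 / (a * t\<^sup>2 - b * t + c))) (at t)"
    by (intro DERIV_cmult DERIV_add)
  moreover have "2 / s * (s / 2 / x + s / 2 / y) = 1 / x + 1 / y" for x y :: real
    using s by (simp add: distrib_left)
  ultimately show ?thesis
    unfolding strip_primitive_def[abs_def] Let_def s_def[symmetric] by (simp only:)
qed

text \<open>On each cell the mean value theorem writes the increment of F as \<open>f z\<close> / n,
  and uniform continuity compares \<open>f z\<close> with the value at the right end. The primitive
  used below contains ln x, hence the derivative is asked for inside the interval and continuity at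
  its ends.\<close>

lemma riemann_sum_tendsto:
  fixes F f :: "real \<Rightarrow> real"
  assumes cont: "continuous_on {0..1} F" "continuous_on {0..1} f"
    and deriv: "\<And>x. 0 < x \<Longrightarrow> x < 1 \<Longrightarrow> (F has_field_derivative f x) (at x)"
  shows "(\<lambda>n. \<Sum>j = 1..n. f (real j / real n) / real n) \<longlonglongrightarrow> F 1 - F 0"
proof (rule LIMSEQ_I)
  fix e :: real assume "e > 0"
  have "uniformly_continuous_on {0..1} f"
    using cont(2) by (intro compact_uniformly_continuous) auto
  then obtain d where d: "d > 0"
    "\<And>x y. x \<in> {0..1} \<Longrightarrow> y \<in> {0..1} \<Longrightarrow> dist y x < d \<Longrightarrow> dist (f y) (f x) < e"
    unfolding uniformly_continuous_on_def using \<open>e > 0\<close> by metis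
  obtain N :: nat where N: "N > 0" "1 / real N < d"
    using d(1) by (meson nat_approx_posE zero_less_Suc)
  show "\<exists>no. \<forall>n\<ge>no. norm ((\<Sum>j = 1..n. f (real j / real n) / real n) - (F 1 - F 0)) < e"
  proof (intro exI[of _ N] allI impI)
    fix n :: nat assume "n \<ge> N"
    hence n: "n > 0" "1 / real n < d"
      using N by (auto intro: le_less_trans[rotated] simp: frac_le)
    have step: "norm (f (real j / real n) / real n - (F (real j / real n) - F (real (j - 1) / real n))) < e / real n"
      if j: "j \<in> {1..n}" for j
    proof -
      have lt: "real (j - 1) / real n < real j / real n"
        using n j by (intro divide_strict_right_mono) auto
      have diff: "real j / real n - real (j - 1) / real n = 1 / real n"
        using j by (simp add: of_nat_diff diff_divide_distrib)
      have bd: "0 \<le> real (j - 1) / real n" "real j / real n \<le> 1" using j n by auto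
      have "continuous_on {real (j - 1) / real n..real j / real n} F"
        using bd by (intro continuous_on_subset[OF cont(1)]) auto
      moreover have "(F has_field_derivative f x) (at x)" if "real (j - 1) / real n < x" "x < real j / real n" for x
        by (intro deriv le_less_trans[OF bd(1) that(1)] less_le_trans[OF that(2) bd(2)])
      ultimately obtain l z where z: "real (j - 1) / real n < z" "z < real j / real n"
         "(F has_field_derivative l) (at z)"
         "F (real j / real n) - F (real (j - 1) / real n) = (real j / real n - real (j - 1) / real n) * l"
        using MVT[OF lt, of F] real_differentiable_def by metis
      have "l = f z"
        by (intro DERIV_unique[OF z(3) deriv] le_less_trans[OF bd(1) z(1)] less_le_trans[OF z(2) bd(2)])
      note z = z(1,2) z(4)[unfolded this]
      have "dist (f (real j / real n)) (f z) < e"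
        using z bd diff n le_less_trans[OF bd(1) z(1)] less_le_trans[OF z(2) bd(2)]
        by (intro d(2)) (auto simp: dist_real_def)
      hence "\<bar>f (real j / real n) - f z\<bar> / real n < e / real n"
        using n by (intro divide_strict_right_mono) (auto simp: dist_real_def)
      thus ?thesis using n unfolding z(3) diff
        by (simp add: diff_divide_distrib[symmetric])
    qed
    have "F 1 - F 0 = (\<Sum>j = 1..n. F (real j / real n) - F (real (j - 1) / real n))"
      using n sum_telescope''[of 0 n "\<lambda>j. F (real j / real n)"] by (simp add: atLeastSucAtMost_greaterThanAtMost)
    hence "norm ((\<Sum>j = 1..n. f (real j / real n) / real n) - (F 1 - F 0)) =
       norm (\<Sum>j = 1..n. f (real j / real n) / real n - (F (real j / real n) - F (real (j - 1) / real n)))"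
      by (simp add: sum_subtractf)
    also have "\<dots> \<le> (\<Sum>j = 1..n. norm (f (real j / real n) / real n - (F (real j / real n) - F (real (j - 1) / real n))))"
      by (rule norm_sum)
    also have "\<dots> < (\<Sum>j = 1..n. e / real n)"
      by (rule sum_strict_mono) (use n step in auto)
    also have "\<dots> = e" using n by simp
    finally show "norm ((\<Sum>j = 1..n. f (real j / real n) / real n) - (F 1 - F 0)) < e" .
  qed
qed

text \<open>The sum is a Riemann sum for g x / x on [0, 1], with g the strip primitive. Integration
  by parts moves the factor 1 / x to ln x and replaces g by its derivative, a pair of inverse
  quadratic polynomials, whose integrals against ln x are known. The product ln x * g x vanishes at
  both ends.\<close>

lemma strip_riemann_sum_tendsto:
  fixes a b c :: real
  assumes "a > 0" "c > 0" "b\<^sup>2 < 4 * a * c"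
  defines "s \<equiv> sqrt (4 * a * c - b\<^sup>2)"
  shows "(\<lambda>n. \<Sum>j = 1..<n. strip_primitive a b c (real j / real n) / real j) \<longlonglongrightarrow>
     (bqf_clausen a b c - (pi / 2 - arctan ((c - a) / s)) * ln (c / a)) / s"
proof -
  define g where "g = strip_primitive a b c"
  \<comment> \<open>The value 2 / c is the derivative of g at 0, so h extends g x / x
    continuously.\<close>
  define h where "h = (\<lambda>x. if x = 0 then 2 / c else g x / x)"
  define F where "F = (\<lambda>x. ln x * g x + (log_quadratic_primitive a b c x + log_quadratic_primitive a (-b) c x))"
  have s: "s > 0" "s\<^sup>2 = 4 * a * c - b\<^sup>2" using assms by (auto simp: s_def)
  have g': "(g has_field_derivative
     1 / (a * t\<^sup>2 + b * t + c) + 1 / (a * t\<^sup>2 - b * t + c)) (at t)" for t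
    unfolding g_def using assms by (intro has_field_derivative_strip_primitive)
  have g0: "((\<lambda>x. g x / x) \<longlongrightarrow> 2 / c) (at 0)"
    using g'[of 0] by (simp add: DERIV_def g_def)
  have contg: "isCont g x" for x using g' DERIV_isCont by blast
  have conth: "continuous_on {0..1} h"
  proof (intro continuous_at_imp_continuous_on ballI)
    fix x :: real
    show "isCont h x"
    proof (cases "x = 0")
      case True
      have "(h \<longlongrightarrow> h 0) (at 0) \<longleftrightarrow> ((\<lambda>x. g x / x) \<longlongrightarrow> h 0) (at 0)"
        by (intro filterlim_cong) (auto simp: h_def eventually_at_filter)
      thus ?thesis using g0 True by (simp add: isCont_def h_def)
    next
      case False
      hence "eventually (\<lambda>y. h y = g y / y) (nhds x)"
        by (intro eventually_mono[OF t1_space_nhds]) (auto simp: h_def)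
      moreover have "isCont (\<lambda>y. g y / y) x" using False contg by (intro continuous_intros) auto
      ultimately show ?thesis by (simp add: isCont_cong)
    qed
  qed
  have contF: "continuous_on {0..1} F"
  proof -
    have "continuous (at x within {0..1}) (\<lambda>x. ln x * g x)" if "x \<in> {0..1}" for x :: real
    proof (cases "x = 0")
      case True
      \<comment> \<open>The logarithm diverges at 0, but g vanishes there to first order, so the
        factor x can be shifted to the logarithm.\<close>
      have "((\<lambda>x. (x * ln x) * (g x / x)) \<longlongrightarrow> 0 * (2 / c)) (at_right 0)"
      proof (rule tendsto_mult)
        show "((\<lambda>x. x * ln x) \<longlongrightarrow> 0) (at_right (0::real))" by real_asymp
        show "((\<lambda>x. g x / x) \<longlongrightarrow> 2 / c) (at_right 0)"
          by (rule filterlim_mono[OF g0 order_refl at_le]) auto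
      qed
      moreover have "eventually (\<lambda>x. (x * ln x) * (g x / x) = ln x * g x) (at_right (0::real))"
        by (auto simp: eventually_at_filter)
      ultimately have "((\<lambda>x. ln x * g x) \<longlongrightarrow> 0) (at_right 0)"
        using Lim_transform_eventually[of "\<lambda>x. (x * ln x) * (g x / x)" "0 * (2 / c)" "at_right 0" "\<lambda>x. ln x * g x"]
        by simp
      hence "((\<lambda>x. ln x * g x) \<longlongrightarrow> 0) (at 0 within {0..1})"
        by (simp add: at_within_Icc_at_right)
      thus ?thesis using True by (simp add: continuous_within)
    next
      case False
      hence "isCont (\<lambda>x. ln x * g x) x" by (intro isCont_mult contg isCont_ln) auto
      thus ?thesis by (rule continuous_at_imp_continuous_at_within)
    qed
    hence "continuous_on {0..1} (\<lambda>x. ln x * g x)"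
      by (simp add: continuous_on_eq_continuous_within)
    moreover have "continuous_on {0..1} (\<lambda>x. log_quadratic_primitive a b' c x)" if "b'\<^sup>2 < 4 * a * c" for b'
      using that assms isCont_log_quadratic_primitive
      by (intro continuous_at_imp_continuous_on ballI)
    ultimately show ?thesis
      unfolding F_def using assms by (intro continuous_on_add) auto
  qed
  have F': "(F has_field_derivative h x) (at x)" if "0 < x" for x
  proof -
    define D where "D = 1 / (a * x\<^sup>2 + b * x + c) + 1 / (a * x\<^sup>2 - b * x + c)"
    have "((\<lambda>x. log_quadratic_primitive a b c x + log_quadratic_primitive a (-b) c x)
        has_field_derivative - ln x * D) (at x)"
      using has_field_derivative_log_quadratic_primitive[of a c b x]
       has_field_derivative_log_quadratic_primitive[of a c "-b" x] assms that
      by (auto intro!: derivative_eq_intros simp: D_def algebra_simps)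
    moreover have "((\<lambda>x. ln x * g x) has_field_derivative (ln x * D + g x / x)) (at x)"
      using g'[of x] that by (auto intro!: derivative_eq_intros simp: D_def)
    ultimately have "(F has_field_derivative (ln x * D + g x / x) + - ln x * D) (at x)"
      unfolding F_def by (rule DERIV_add[rotated])
    thus ?thesis using that by (simp add: h_def)
  qed
  have "(\<lambda>n. \<Sum>j = 1..n. h (real j / real n) / real n) \<longlonglongrightarrow> F 1 - F 0"
    by (rule riemann_sum_tendsto[OF contF conth]) (use F' in auto)
  \<comment> \<open>The Riemann sum contains j = n, while the rows stop at n - 1; the surplus term
    is \<open>h 1\<close> / n.\<close>
  moreover have "(\<lambda>n. h 1 / real n) \<longlonglongrightarrow> 0" by real_asymp
  ultimately have "(\<lambda>n. (\<Sum>j = 1..n. h (real j / real n) / real n) - h 1 / real n) \<longlonglongrightarrow> F 1 - F 0 - 0"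
    by (rule tendsto_diff)
  moreover have "eventually (\<lambda>n. (\<Sum>j = 1..n. h (real j / real n) / real n) - h 1 / real n =
      (\<Sum>j = 1..<n. g (real j / real n) / real j)) sequentially"
    using eventually_gt_at_top[of "0::nat"]
  proof eventually_elim
    case (elim n)
    hence "{1..n} = insert n {1..<n}" by auto
    hence "(\<Sum>j = 1..n. h (real j / real n) / real n) = h 1 / real n + (\<Sum>j = 1..<n. h (real j / real n) / real n)"
      using elim by simp
    moreover have "(\<Sum>j = 1..<n. h (real j / real n) / real n) = (\<Sum>j = 1..<n. g (real j / real n) / real j)"
      using elim by (intro sum.cong) (auto simp: h_def)
    ultimately show ?case by simp
  qed
  ultimately have lim: "(\<lambda>n. \<Sum>j = 1..<n. g (real j / real n) / real j) \<longlonglongrightarrow> F 1 - F 0"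
    using Lim_transform_eventually[where l = "F 1 - F 0 - 0" and g = "\<lambda>n. \<Sum>j = 1..<n. g (real j / real n) / real j"]
    by simp
  have "F 1 - F 0 = (bqf_clausen a b c - (pi / 2 - arctan ((c - a) / s)) * ln (c / a)) / s"
  proof -
    have frac: "b / s < (2 * a + b) / s" "-b / s < (2 * a - b) / s"
      by (rule divide_strict_right_mono; use s(1) \<open>a > 0\<close> in linarith)+
    have ss: "s * s = 4 * a * c - b * b" using s by (simp add: power2_eq_square)
    have sum: "arctan ((2 * a + b) / s) + arctan ((2 * a - b) / s) = pi / 2 - arctan ((c - a) / s)"
      unfolding s_def using assms(1,3) by (rule arctan_sum_complement)
    \<comment> \<open>The value of u - u0 at t = 1 for b' = b and b' = -b. Since s^2 + b^2 = 4 a c,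
      it is the complement of an angle containing c, so 2 (u - u0) becomes one of the two kinds of
      argument in \<open>bqf_clausen\<close>.\<close>
    have diff: "arctan ((2 * a + b') / s) - arctan (b' / s) = pi / 2 - arctan ((2 * c + b') / s)"
      if "b' / s < (2 * a + b') / s" "b' * b' = b * b" for b'
    proof -
      have "(1 + b' / s * ((2 * a + b') / s)) / ((2 * a + b') / s - b' / s) = (s * s + (b' * b' + 2 * a * b')) / (2 * a * s)"
        using s(1) assms by (simp add: field_simps)
      also have "\<dots> = (2 * c + b') / s" unfolding ss that(2) using s(1) assms by (simp add: field_simps)
      finally show ?thesis using arctan_diff_complement[OF that(1)] by simp
    qed
    have d1: "arctan ((2 * a + b) / s) - arctan (b / s) = pi / 2 - arctan ((2 * c + b) / s)"
      using diff[of b] frac by simp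
    have d2: "arctan ((2 * a - b) / s) + arctan (b / s) = pi / 2 - arctan ((2 * c - b) / s)"
      using diff[of "-b"] frac by (simp add: arctan_minus)
    \<comment> \<open>At t = 0 the primitives for b and -b leave Cl_2 at pi - 2 arctan (b/s) and at
      pi + 2 arctan (b/s). These cancel because Cl_2 is odd about pi, whence F 0 = 0.\<close>
    have cl: "clausen2 (pi + 2 * arctan (b / s)) = - clausen2 (pi - 2 * arctan (b / s))"
      using clausen2_2pi_minus[of "pi - 2 * arctan (b / s)"] by simp
    have cl0: "clausen2 0 = 0" by (simp add: clausen2_def)
    have sabs: "sqrt \<bar>bqf_disc a b c\<bar> = s" using assms by (simp add: bqf_disc_def s_def)
    have e1: "2 * (pi / 2 - x) = pi - 2 * x" for x :: real by simp
    define L where "L = ln (c / a)"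
    have L1: "log_quadratic_primitive a b c 1 = (clausen2 (pi - 2 * arctan ((2 * c + b) / s)) +
        clausen2 (pi - 2 * arctan ((2 * a + b) / s)) - (pi / 2 - arctan ((2 * c + b) / s)) * L) / s"
      unfolding log_quadratic_primitive_def Let_def s_def[symmetric] mult_1_right d1 e1 L_def ..
    have "log_quadratic_primitive a (-b) c 1 =
       (clausen2 (2 * (arctan ((2 * a - b) / s) + arctan (b / s))) +
        clausen2 (pi - 2 * arctan ((2 * a - b) / s)) - (arctan ((2 * a - b) / s) + arctan (b / s)) * L) / s"
      unfolding log_quadratic_primitive_def Let_def power2_minus s_def[symmetric] L_def
      by (simp add: arctan_minus)
    hence L2: "log_quadratic_primitive a (-b) c 1 = (clausen2 (pi - 2 * arctan ((2 * c - b) / s)) +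
        clausen2 (pi - 2 * arctan ((2 * a - b) / s)) - (pi / 2 - arctan ((2 * c - b) / s)) * L) / s"
      unfolding d2 e1 .
    have L3: "pi / 2 - arctan ((c - a) / s) = (pi / 2 - arctan ((2 * c + b) / s)) + (pi / 2 - arctan ((2 * c - b) / s))"
      using d1 d2 sum by linarith
    have split: "(X + Y - p * L) / s + (X' + Y' - q * L) / s = (X + Y + X' + Y' - (p + q) * L) / s"
      for X Y X' Y' p q by (simp add: add_divide_distrib diff_divide_distrib distrib_right)
    have "F 1 = log_quadratic_primitive a b c 1 + log_quadratic_primitive a (-b) c 1"
      by (simp add: F_def)
    hence F1: "F 1 = (clausen2 (pi - 2 * arctan ((2 * c + b) / s)) + clausen2 (pi - 2 * arctan ((2 * a + b) / s))
        + clausen2 (pi - 2 * arctan ((2 * c - b) / s)) + clausen2 (pi - 2 * arctan ((2 * a - b) / s))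
         - (pi / 2 - arctan ((c - a) / s)) * ln (c / a)) / s"
      unfolding L1 L2 L3 L_def[symmetric] split .
    have F0: "F 0 = 0"
      unfolding F_def log_quadratic_primitive_def Let_def
      using s(1) by (simp add: s_def[symmetric] arctan_minus cl0 cl)
    show ?thesis
      unfolding F1 F0 bqf_clausen_def Let_def sabs by (simp add: add_ac)
  qed
  with lim show ?thesis by (simp add: g_def)
qed

section \<open>Complete rows and the eta function\<close>

text \<open>The logarithmic derivative of Gamma z Gamma (1 - z) = pi / sin (pi z), obtained by
  differentiating both sides and invoking uniqueness of the derivative.\<close>

lemma Digamma_reflection:
  fixes z :: complex
  assumes "z \<notin> \<int>"
  shows "Digamma (1 - z) - Digamma z = of_real pi * cot (of_real pi * z)"
proof -
  have z: "z \<notin> \<int>\<^sub>\<le>\<^sub>0" "1 - z \<notin> \<int>\<^sub>\<le>\<^sub>0"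
    using assms by (auto simp: nonpos_Ints_def minus_in_Ints_iff) (metis Ints_1 Ints_diff Ints_of_int diff_diff_eq2 add_diff_cancel_left' )
  define S C D where "S = sin (of_real pi * z)" and "C = cos (of_real pi * z)"
    and "D = Digamma z - Digamma (1 - z)"
  have sin: "sin (of_real pi * z) \<noteq> 0"
  proof
    assume "sin (of_real pi * z) = 0"
    then obtain n :: int where "of_real pi * z = of_real (of_int n * pi)"
      by (auto simp: Complex_Transcendental.sin_eq_0)
    hence "z = of_int n" by simp
    thus False using assms by simp
  qed
  have "((\<lambda>z. Gamma z * Gamma (1 - z)) has_field_derivative
      Gamma z * Gamma (1 - z) * (Digamma z - Digamma (1 - z))) (at z)"
    using z by (auto intro!: derivative_eq_intros simp: algebra_simps)
  moreover have "((\<lambda>z. of_real pi / sin (of_real pi * z)) has_field_derivative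
      - (of_real pi * of_real pi * cos (of_real pi * z)) / (sin (of_real pi * z))\<^sup>2) (at z)"
    using sin by (auto intro!: derivative_eq_intros simp: power2_eq_square)
  ultimately have "Gamma z * Gamma (1 - z) * (Digamma z - Digamma (1 - z)) =
      - (of_real pi * of_real pi * cos (of_real pi * z)) / (sin (of_real pi * z))\<^sup>2"
    unfolding Gamma_reflection_complex by (rule DERIV_unique)
  hence eq: "of_real pi / S * D = - (of_real pi * of_real pi * C) / S\<^sup>2"
    unfolding Gamma_reflection_complex S_def C_def D_def .
  have "D = S / of_real pi * (of_real pi / S * D)" using sin by (simp add: S_def)
  also have "\<dots> = - (of_real pi * (C / S))"
    unfolding eq using sin by (simp add: S_def power2_eq_square)
  finally show ?thesis
    by (simp add: cot_def D_def S_def C_def algebra_simps)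
qed

text \<open>In the difference of the Digamma series at 1 - z and 1 + z the convergence terms 1/n
  cancel. The recurrence Digamma (1 + z) = Digamma z + 1/z then produces -1/z.\<close>

lemma cot_partial_fractions:
  fixes z :: complex
  assumes "z \<notin> \<int>"
  shows "(\<lambda>n. 1 / (of_nat (Suc n) + z) - 1 / (of_nat (Suc n) - z)) sums
           (of_real pi * cot (of_real pi * z) - 1 / z)"
proof -
  have nz: "z \<noteq> 0" "1 - z \<noteq> 0" "1 + z \<noteq> 0"
    using assms by (auto simp: add_eq_0_iff)
  have "(\<lambda>n. inverse (of_nat (Suc n)) - inverse (w + of_nat n)) sums (Digamma w + euler_mascheroni)"
    if "w \<noteq> 0" for w :: complex
    using summable_sums[OF summable_Digamma[OF that]] by (simp add: Digamma_def)
  from sums_diff[OF this[OF nz(2)] this[OF nz(3)]]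
  have "(\<lambda>n. inverse (1 + z + of_nat n) - inverse (1 - z + of_nat n)) sums (Digamma (1 - z) - Digamma (1 + z))"
    by simp
  also have "Digamma (1 - z) - Digamma (1 + z) = of_real pi * cot (of_real pi * z) - 1 / z"
    using Digamma_reflection[OF assms] Digamma_plus1[OF nz(1)] by (simp add: algebra_simps)
  finally show ?thesis
    by (simp add: inverse_eq_divide algebra_simps)
qed

text \<open>In the upper half-plane the exponential has modulus below 1. Written this way, the
  cotangent splits into its limit -i at i times infinity and a Lambert term.\<close>

lemma cot_eq_exp:
  fixes z :: complex
  assumes "Im z > 0"
  shows "cot (of_real pi * z) = - \<i> * ((1 + exp (2 * of_real pi * \<i> * z)) / (1 - exp (2 * of_real pi * \<i> * z)))"
proof -
  define E where "E = exp (\<i> * (of_real pi * z))"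
  have "2 * of_real pi * \<i> * z = \<i> * (of_real pi * z) + \<i> * (of_real pi * z)"
    by (simp add: algebra_simps)
  hence E2: "exp (2 * of_real pi * \<i> * z) = E * E"
    by (simp only: E_def exp_add)
  have "cmod (exp (2 * of_real pi * \<i> * z)) < 1"
    using assms by (simp add: mult_pos_pos)
  hence ne: "1 - E * E \<noteq> 0" unfolding E2 by auto
  have E0: "E \<noteq> 0" by (simp add: E_def)
  have "cot (of_real pi * z) = ((E + inverse E) / 2) / ((E - inverse E) / (2 * \<i>))"
    unfolding cot_def sin_exp_eq cos_exp_eq exp_minus E_def ..
  also have "\<dots> = \<i> * ((E * E + 1) / (E * E - 1))"
    using E0 ne by (simp add: divide_simps)
  also have "\<dots> = - \<i> * ((1 + E * E) / (1 - E * E))"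
    using ne by (simp add: divide_simps) (simp add: algebra_simps)
  finally show ?thesis unfolding E2 .
qed

text \<open>The two summands are exchanged by y \<rightarrow> -y, so summing pairs over y \<ge> 1
  means summing one inverse form over all nonzero integers y, as the partial fractions of the
  cotangent do.\<close>

definition form_pair :: "real \<Rightarrow> real \<Rightarrow> real \<Rightarrow> real \<Rightarrow> real \<Rightarrow> real" where
  "form_pair a b c x y = 1 / (a * x\<^sup>2 - b * x * y + c * y\<^sup>2) + 1 / (a * x\<^sup>2 + b * x * y + c * y\<^sup>2)"

text \<open>With \<mu> the form factors as a j^2 - b j k + c k^2 = c |k + j \<mu>|^2, and cot (pi j
  \<mu>) is a rational function of the j-th power of this number.\<close>

definition nome :: "real \<Rightarrow> real \<Rightarrow> real \<Rightarrow> complex" where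
  "nome a b c = exp (2 * of_real pi * \<i> * bqf_mu a b c)"

lemma Im_bqf_mu:
  assumes "b\<^sup>2 < 4 * a * c"
  shows "Im (bqf_mu a b c) = sqrt (4 * a * c - b\<^sup>2) / (2 * c)" "Re (bqf_mu a b c) = - b / (2 * c)"
proof -
  have "sqrt \<bar>bqf_disc a b c\<bar> = sqrt (4 * a * c - b\<^sup>2)" using assms by (simp add: bqf_disc_def)
  hence "bqf_mu a b c = Complex (- b / (2 * c)) (sqrt (4 * a * c - b\<^sup>2) / (2 * c))"
    unfolding bqf_mu_def by (simp add: complex_eq_iff)
  thus "Im (bqf_mu a b c) = sqrt (4 * a * c - b\<^sup>2) / (2 * c)" "Re (bqf_mu a b c) = - b / (2 * c)"
    by simp_all
qed

lemma cmod_nome_less_1: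
  assumes "c > 0" "b\<^sup>2 < 4 * a * c"
  shows "cmod (nome a b c) < 1"
  using assms by (simp add: nome_def Im_bqf_mu)

text \<open>For z = j \<mu> the inverse form is -Im (1/(k + z)) / (c Im z), and c Im z = j s / 2. In
  cot (pi z) = -i (1 + 2 q^j/(1 - q^j)) the 1 gives the harmonic term and the rest the Lambert term;
  the -1/z beside the cotangent gives -1/(a j^2).\<close>

lemma row_sum:
  fixes a b c :: real and j :: nat
  assumes "a > 0" "c > 0" "b\<^sup>2 < 4 * a * c" "j > 0"
  defines "s \<equiv> sqrt (4 * a * c - b\<^sup>2)"
  shows "(\<lambda>k. form_pair a b c j (Suc k)) sums
    (2 * pi / s * (1 / j) + 4 * pi / s * (Re (nome a b c ^ j / (1 - nome a b c ^ j)) / j) - 1 / (a * j\<^sup>2))"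
proof -
  have s: "s > 0" "s\<^sup>2 = 4 * a * c - b\<^sup>2" using assms by (auto simp: s_def)
  define z where "z = of_nat j * bqf_mu a b c"
  have z: "Re z = - (j * b / (2 * c))" "Im z = j * s / (2 * c)"
    using assms by (simp_all add: z_def Im_bqf_mu s_def)
  have Imz: "Im z > 0" using s assms by (simp add: z)
  have zint: "z \<notin> \<int>"
    using Imz by (auto elim!: Ints_cases)
  define w where "w = nome a b c ^ j"
  have w: "w = exp (2 * of_real pi * \<i> * z)"
    unfolding w_def nome_def z_def exp_of_nat_mult[symmetric] by (simp add: algebra_simps)
  have "cmod w < 1" using Imz unfolding w by (simp add: mult_pos_pos)
  hence w1: "1 - w \<noteq> 0" by auto
  have inv: "1 / (a * (real j)\<^sup>2 - b * j * x + c * x\<^sup>2) = - 2 / (s * j) * Im (1 / (of_real x + z))" for x :: real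
  proof -
    have "c * ((x + Re z)\<^sup>2 + (Im z)\<^sup>2) = c * x\<^sup>2 - b * j * x + (real j)\<^sup>2 * (b\<^sup>2 + s\<^sup>2) / (4 * c)"
      unfolding z using assms by (simp add: field_simps power2_eq_square)
    also have "(real j)\<^sup>2 * (b\<^sup>2 + s\<^sup>2) / (4 * c) = a * (real j)\<^sup>2"
      unfolding s using assms by simp
    finally have "a * (real j)\<^sup>2 - b * j * x + c * x\<^sup>2 = c * ((x + Re z)\<^sup>2 + (Im z)\<^sup>2)" by simp
    hence "1 / (a * (real j)\<^sup>2 - b * j * x + c * x\<^sup>2) = 1 / (c * ((x + Re z)\<^sup>2 + (Im z)\<^sup>2))" by simp
    also have "\<dots> = (1 / c) * (1 / ((x + Re z)\<^sup>2 + (Im z)\<^sup>2))" by simp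
    also have "1 / c = - 2 / (s * j) * (- Im z)" using s assms by (simp add: z)
    also have "- 2 / (s * j) * (- Im z) * (1 / ((x + Re z)\<^sup>2 + (Im z)\<^sup>2)) = - 2 / (s * j) * Im (1 / (of_real x + z))"
      by (simp add: Im_divide)
    finally show ?thesis .
  qed
  have trm: "form_pair a b c j (Suc k) = - 2 / (s * j) * Im (1 / (of_nat (Suc k) + z) - 1 / (of_nat (Suc k) - z))" for k
  proof -
    \<comment> \<open>The form with +b at k + 1 is the form with -b at the negative integer -(k +
      1).\<close>
    have "1 / (a * (real j)\<^sup>2 + b * j * real (Suc k) + c * (real (Suc k))\<^sup>2) = - 2 / (s * j) * Im (1 / (of_real (- real (Suc k)) + z))"
      using inv[of "- real (Suc k)"] by (simp del: of_nat_Suc)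
    also have "1 / (of_real (- real (Suc k)) + z) = - (1 / (of_nat (Suc k) - z))"
      by (metis minus_diff_eq minus_divide_right of_real_minus of_real_of_nat_eq uminus_add_conv_diff add.commute diff_minus_eq_add)
    finally show ?thesis
      unfolding form_pair_def using inv[of "real (Suc k)"] by (simp add: algebra_simps del: of_nat_Suc)
  qed
  have "(\<lambda>k. - 2 / (s * j) * Im (1 / (of_nat (Suc k) + z) - 1 / (of_nat (Suc k) - z))) sums
        (- 2 / (s * j) * Im (of_real pi * cot (of_real pi * z) - 1 / z))"
    by (intro sums_mult sums_Im cot_partial_fractions zint)
  moreover have "- 2 / (s * j) * Im (of_real pi * cot (of_real pi * z) - 1 / z) =
     2 * pi / s * (1 / j) + 4 * pi / s * (Re (w / (1 - w)) / j) - 1 / (a * j\<^sup>2)"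
  proof -
    have "(1 + w) / (1 - w) = 1 + 2 * (w / (1 - w))" using w1 by (simp add: field_simps)
    hence "Im (of_real pi * cot (of_real pi * z)) = - pi * (1 + 2 * Re (w / (1 - w)))"
    proof -
      have "Im (of_real pi * (- \<i> * (1 + 2 * x))) = - pi * (1 + 2 * Re x)" for x
        by simp
      with \<open>_ = 1 + 2 * (w / (1 - w))\<close> show ?thesis
        unfolding cot_eq_exp[OF Imz] w[symmetric] by (simp only:)
    qed
    moreover have "- 2 / (s * j) * Im (1 / z) = 1 / (a * j\<^sup>2)"
      using inv[of 0] by simp
    moreover have "- 2 / (s * j) * (- pi * (1 + 2 * X)) = 2 * pi / s * (1 / j) + 4 * pi / s * (X / j)" for X
      using s assms by (simp add: field_simps)
    ultimately show ?thesis by (simp add: right_diff_distrib)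
  qed
  ultimately show ?thesis unfolding trm w_def[symmetric] by simp
qed

text \<open>Both are iterated sums of q^(j m)/j over positive j and m: a geometric series in m, a
  logarithmic series in j. Absolute summability of the double series makes the two orders
  agree.\<close>

lemma lambert_series_sums:
  fixes q :: complex
  assumes "cmod q < 1"
  shows "\<exists>S. (\<lambda>j. q ^ Suc j / (1 - q ^ Suc j) / of_nat (Suc j)) sums S \<and>
             (\<lambda>m. - ln (1 - q ^ Suc m)) sums S"
proof -
  define f where "f = (\<lambda>(j, m). q ^ (Suc j * Suc m) / of_nat (Suc j))"
  have "(\<lambda>(j, m). cmod q ^ j * cmod q ^ m) summable_on UNIV \<times> UNIV"
  proof (rule summable_on_SigmaI)
    have sums: "(\<lambda>m. cmod q ^ m) sums (1 / (1 - cmod q))"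
      using assms by (intro geometric_sums) simp
    hence hs: "((\<lambda>m. cmod q ^ m) has_sum (1 / (1 - cmod q))) UNIV"
      by (intro sums_nonneg_imp_has_sum) auto
    show "((\<lambda>m. case (j, m) of (j, m) \<Rightarrow> cmod q ^ j * cmod q ^ m) has_sum (cmod q ^ j * (1 / (1 - cmod q)))) UNIV" for j
      using has_sum_cmult_right[OF hs, of "cmod q ^ j"] by simp
    show "(\<lambda>j. cmod q ^ j * (1 / (1 - cmod q))) summable_on UNIV"
      using hs has_sum_cmult_left summable_on_def by blast
  qed auto
  hence "(\<lambda>x. norm (case x of (j, m) \<Rightarrow> cmod q ^ j * cmod q ^ m)) summable_on UNIV \<times> UNIV"
    by (simp add: case_prod_unfold)
  hence "(\<lambda>x. norm (f x)) summable_on UNIV \<times> UNIV"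
  proof (rule Infinite_Sum.abs_summable_on_comparison_test)
    fix x :: "nat \<times> nat"
    obtain j m where x: "x = (j, m)" by fastforce
    \<comment> \<open>The exponent satisfies (j + 1)(m + 1) \<ge> j + m, which yields a majorant of
      product form.\<close>
    have "cmod q ^ (Suc j * Suc m) / real (Suc j) \<le> cmod q ^ (j + m) / 1"
      using assms by (intro frac_le power_decreasing) auto
    thus "norm (f x) \<le> norm (case x of (j, m) \<Rightarrow> cmod q ^ j * cmod q ^ m)"
      by (simp add: f_def x norm_divide norm_power power_add norm_mult del: of_nat_Suc)
  qed
  then obtain S where S: "(f has_sum S) (UNIV \<times> UNIV)"
    using abs_summable_summable summable_on_def by blast
  have pw: "cmod (q ^ Suc j) < 1" for j
    using assms power_Suc_less_one[of "cmod q" j] by (cases "q = 0") (auto simp: norm_power norm_mult)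
  have row: "((\<lambda>m. f (j, m)) has_sum (q ^ Suc j / (1 - q ^ Suc j) / of_nat (Suc j))) UNIV" for j
  proof (rule norm_summable_imp_has_sum)
    have feq: "f (j, m) = q ^ Suc j / of_nat (Suc j) * (q ^ Suc j) ^ m" for m
      unfolding f_def prod.case power_mult by (simp del: of_nat_Suc)
    have "(\<lambda>m. (q ^ Suc j) ^ m) sums (1 / (1 - q ^ Suc j))"
      by (rule geometric_sums[OF pw])
    from sums_mult[OF this, of "q ^ Suc j / of_nat (Suc j)"]
    show "(\<lambda>m. f (j, m)) sums (q ^ Suc j / (1 - q ^ Suc j) / of_nat (Suc j))"
      unfolding feq by (simp add: mult.commute del: of_nat_Suc power_Suc)
    have "summable (\<lambda>m. cmod (q ^ Suc j) ^ m * (cmod (q ^ Suc j) / real (Suc j)))"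
      using pw by (intro summable_mult2 summable_geometric) simp
    thus "summable (\<lambda>m. norm (f (j, m)))"
      unfolding feq by (simp add: norm_divide norm_power norm_mult mult_ac del: of_nat_Suc power_Suc)
  qed
  have col: "((\<lambda>j. f (j, m)) has_sum (- ln (1 - q ^ Suc m))) UNIV" for m
  proof (rule norm_summable_imp_has_sum)
    have "(\<lambda>n. - ((q ^ Suc m) ^ n) / of_nat n) sums ln (1 - q ^ Suc m)"
      using Ln_series'[of "- (q ^ Suc m)"] pw by (simp del: power_Suc)
    hence "(\<lambda>n. - ((q ^ Suc m) ^ Suc n) / of_nat (Suc n)) sums ln (1 - q ^ Suc m)"
      by (subst sums_Suc_iff) simp
    from sums_minus[OF this] show "(\<lambda>j. f (j, m)) sums (- ln (1 - q ^ Suc m))"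
      by (simp add: f_def power_mult[symmetric] mult.commute del: of_nat_Suc power_Suc)
    have "summable (\<lambda>n. cmod (q ^ Suc m) * cmod (q ^ Suc m) ^ n)"
      using pw by (intro summable_mult summable_geometric) simp
    thus "summable (\<lambda>j. norm (f (j, m)))"
    proof (rule summable_comparison_test')
      fix j
      have "cmod (q ^ Suc m) ^ Suc j / real (Suc j) \<le> cmod (q ^ Suc m) ^ Suc j / 1"
        by (intro frac_le) auto
      thus "norm (norm (f (j, m))) \<le> cmod (q ^ Suc m) * cmod (q ^ Suc m) ^ j"
        by (simp add: f_def norm_divide norm_power power_mult[symmetric] mult.commute del: of_nat_Suc power_Suc)
          (simp add: power_add mult_ac)
    qed
  qed
  have "((\<lambda>j. q ^ Suc j / (1 - q ^ Suc j) / of_nat (Suc j)) has_sum S) UNIV"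
    using has_sum_SigmaD[OF S row] by simp
  moreover have "((\<lambda>m. - ln (1 - q ^ Suc m)) has_sum S) UNIV"
  proof (rule has_sum_SigmaD)
    show "((\<lambda>(m, j). f (j, m)) has_sum S) (UNIV \<times> UNIV)"
      using S by (subst (asm) has_sum_swap)
  qed (use col in simp)
  ultimately show ?thesis using has_sum_imp_sums by blast
qed

text \<open>Exponentiating the sum of principal logarithms shows that the product is exp (-S). It is
  therefore nonzero, and the logarithm of its modulus is -Re S, free of any choice of
  branch.\<close>

lemma lambert_series_eta:
  fixes q :: complex
  assumes "cmod q < 1"
  shows "(\<Prod>k. 1 - q ^ Suc k) \<noteq> 0"
    and "(\<lambda>j. Re (q ^ Suc j / (1 - q ^ Suc j)) / real (Suc j)) sums - ln (cmod (\<Prod>k. 1 - q ^ Suc k))"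
proof -
  obtain S where S: "(\<lambda>j. q ^ Suc j / (1 - q ^ Suc j) / of_nat (Suc j)) sums S"
    "(\<lambda>m. - ln (1 - q ^ Suc m)) sums S"
    using lambert_series_sums[OF assms] by blast
  have pw: "cmod (q ^ Suc j) < 1" for j
    using assms power_Suc_less_one[of "cmod q" j] by (cases "q = 0") (auto simp: norm_power norm_mult)
  have nz: "1 - q ^ Suc j \<noteq> 0" for j using pw[of j] by auto
  have "(\<lambda>m. ln (1 - q ^ Suc m)) sums (- S)" using sums_minus[OF S(2)] by simp
  hence "(\<Prod>k. exp (ln (1 - q ^ Suc k))) = exp (- S)"
    using prodinf_exp sums_iff by metis
  hence P: "(\<Prod>k. 1 - q ^ Suc k) = exp (- S)"
    using nz by (simp del: power_Suc)
  thus "(\<Prod>k. 1 - q ^ Suc k) \<noteq> 0" by simp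
  have "- ln (cmod (\<Prod>k. 1 - q ^ Suc k)) = Re S" unfolding P by simp
  moreover have "(\<lambda>j. Re (q ^ Suc j / (1 - q ^ Suc j)) / real (Suc j)) sums Re S"
    using sums_Re[OF S(1)] by (simp only: Re_divide_of_nat)
  ultimately show "(\<lambda>j. Re (q ^ Suc j / (1 - q ^ Suc j)) / real (Suc j)) sums - ln (cmod (\<Prod>k. 1 - q ^ Suc k))"
    by simp
qed

text \<open>The last term stems from the exponential prefactor, of modulus exp (-pi Im \<mu> / 12)
  with Im \<mu> = s / (2 c).\<close>

lemma ln_cmod_dedekind_eta:
  assumes "a > 0" "c > 0" "b\<^sup>2 < 4 * a * c"
  shows "ln (cmod (dedekind_eta (bqf_mu a b c))) =
     ln (cmod (\<Prod>k. 1 - nome a b c ^ Suc k)) - pi * sqrt (4 * a * c - b\<^sup>2) / (24 * c)"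
proof -
  define P where "P = (\<Prod>k. 1 - nome a b c ^ Suc k)"
  have P: "P \<noteq> 0"
    unfolding P_def using assms by (intro lambert_series_eta cmod_nome_less_1)
  have "exp (2 * of_real pi * \<i> * of_nat (Suc k) * bqf_mu a b c) = nome a b c ^ Suc k" for k
    unfolding nome_def exp_of_nat_mult[symmetric] by (simp add: algebra_simps)
  hence "dedekind_eta (bqf_mu a b c) = exp (of_real pi * \<i> * bqf_mu a b c / 12) * P"
    unfolding dedekind_eta_def P_def by (simp del: power_Suc of_nat_Suc)
  hence "cmod (dedekind_eta (bqf_mu a b c)) = exp (- (pi * Im (bqf_mu a b c) / 12)) * cmod P"
    by (simp add: norm_mult)
  thus ?thesis
    using P assms unfolding P_def[symmetric] by (simp add: ln_mult_pos Im_bqf_mu)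
qed

section \<open>The constant term\<close>

text \<open>The increments of X are dominated by the decrements of h, so h n bounds |X n - X N| for
  every N \<ge> n, and the bound survives N \<rightarrow> \<infinity>. It is used with h of order
  k^(-2) for the row tails and of order k^(-4) for the final error.\<close>

lemma telescoping_bound_limit:
  fixes X h :: "nat \<Rightarrow> real"
  assumes lim: "X \<longlonglongrightarrow> L"
    and step: "\<And>k. n \<le> k \<Longrightarrow> \<bar>X (Suc k) - X k\<bar> \<le> h k - h (Suc k)"
    and nonneg: "\<And>k. 0 \<le> h k"
  shows "\<bar>X n - L\<bar> \<le> h n"
proof (rule tendsto_upperbound)
  show "(\<lambda>N. \<bar>X n - X N\<bar>) \<longlonglongrightarrow> \<bar>X n - L\<bar>"
    using lim by (intro tendsto_intros)
  have "\<bar>X n - X N\<bar> \<le> h n - h N" if "n \<le> N" for N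
    using that
  proof (induction N rule: dec_induct)
    case (step k)
    thus ?case using assms(2)[of k] by linarith
  qed simp
  thus "\<forall>\<^sub>F N in sequentially. \<bar>X n - X N\<bar> \<le> h n"
    using nonneg by (intro eventually_sequentiallyI[of n]) (smt (verit))
qed simp

lemma sums_imp_LIMSEQ_from_1:
  assumes "(\<lambda>i. u (Suc i)) sums S"
  shows "(\<lambda>n. \<Sum>j = 1..<n. u j) \<longlonglongrightarrow> S"
proof (rule LIMSEQ_imp_Suc)
  have "(\<Sum>j = 1..<Suc n. u j) = (\<Sum>i<n. u (Suc i))" for n
    using sum.shift_bounds_Suc_ivl[of u 0 n] by (simp add: lessThan_atLeast0)
  thus "(\<lambda>n. \<Sum>j = 1..<Suc n. u j) \<longlonglongrightarrow> S"
    using assms by (simp add: sums_def)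
qed

section \<open>Comparison of a row tail with an integral\<close>

lemma form_lower_bound:
  fixes a b c x y :: real
  assumes "a > 0"
  shows "a * x\<^sup>2 + b * x * y + c * y\<^sup>2 \<ge> (c - b\<^sup>2 / (4 * a)) * y\<^sup>2"
proof -
  have "a * x\<^sup>2 + b * x * y + c * y\<^sup>2 = (c - b\<^sup>2 / (4 * a)) * y\<^sup>2 + (2 * a * x + b * y)\<^sup>2 / (4 * a)"
    using assms by (simp add: field_simps power2_eq_square)
  thus ?thesis using assms by simp
qed

text \<open>The forms differ by O(k), and each is at least m k^2 with m > 0 independent of x, which
  gives k / k^4. The uniformity in x is what allows the errors of all rows to be added.\<close>

lemma inverse_form_diff_bound:
  fixes a b c x y k :: real
  assumes "a > 0" "c > 0" "b\<^sup>2 < 4 * a * c" "1 \<le> k" "0 \<le> x" "x \<le> k" "k \<le> y" "y \<le> k + 1"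
  shows "\<bar>1 / (a * x\<^sup>2 + b * x * y + c * y\<^sup>2) - 1 / (a * x\<^sup>2 + b * x * k + c * k\<^sup>2)\<bar>
           \<le> (\<bar>b\<bar> + 3 * c) / (c - b\<^sup>2 / (4 * a))\<^sup>2 / k ^ 3"
proof -
  define m where "m = c - b\<^sup>2 / (4 * a)"
  define Q where "Q = (\<lambda>y. a * x\<^sup>2 + b * x * y + c * y\<^sup>2)"
  have m: "m > 0" using assms by (simp add: m_def field_simps)
  have Q: "Q t \<ge> m * k\<^sup>2" if "k \<le> t" for t
  proof -
    have "m * k\<^sup>2 \<le> m * t\<^sup>2" using that m assms by (intro mult_left_mono power_mono) auto
    thus ?thesis using form_lower_bound[of a c b t x] assms unfolding Q_def m_def by (smt (verit) form_lower_bound)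
  qed
  have mk: "m * k\<^sup>2 > 0" using m assms by simp
  have "\<bar>Q k - Q y\<bar> = \<bar>(y - k) * (b * x + c * (y + k))\<bar>"
    unfolding Q_def by (simp add: power2_eq_square algebra_simps abs_minus_commute)
  also have "\<dots> = (y - k) * \<bar>b * x + c * (y + k)\<bar>" using assms by (simp add: abs_mult)
  also have "\<dots> \<le> 1 * ((\<bar>b\<bar> + 3 * c) * k)"
  proof (intro mult_mono)
    have "\<bar>b * x + c * (y + k)\<bar> \<le> \<bar>b\<bar> * x + c * (y + k)"
      using assms abs_triangle_ineq[of "b * x" "c * (y + k)"] by (simp add: abs_mult)
    \<comment> \<open>Here y + k \<le> 2 k + 1 \<le> 3 k because k \<ge> 1.\<close>
    also have "\<dots> \<le> \<bar>b\<bar> * k + c * (3 * k)"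
      using assms by (intro add_mono mult_left_mono) auto
    finally show "\<bar>b * x + c * (y + k)\<bar> \<le> (\<bar>b\<bar> + 3 * c) * k" by (simp add: algebra_simps)
  qed (use assms in auto)
  finally have num: "\<bar>Q k - Q y\<bar> \<le> (\<bar>b\<bar> + 3 * c) * k" by simp
  have "\<bar>1 / Q y - 1 / Q k\<bar> = \<bar>Q k - Q y\<bar> / (Q y * Q k)"
    using Q[of y] Q[of k] mk assms by (simp add: field_simps abs_mult)
  also have "\<dots> \<le> ((\<bar>b\<bar> + 3 * c) * k) / ((m * k\<^sup>2) * (m * k\<^sup>2))"
    using Q[of y] Q[of k] mk assms num by (intro frac_le mult_mono) auto
  also have "\<dots> = (\<bar>b\<bar> + 3 * c) / m\<^sup>2 / k ^ 3"
    using assms m by (simp add: field_simps power2_eq_square power3_eq_cube)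
  finally show ?thesis unfolding Q_def m_def .
qed

lemma form_pair_diff_bound:
  fixes a b c x y k :: real
  assumes "a > 0" "c > 0" "b\<^sup>2 < 4 * a * c" "1 \<le> k" "0 \<le> x" "x \<le> k" "k \<le> y" "y \<le> k + 1"
  shows "\<bar>form_pair a b c x y - form_pair a b c x k\<bar>
           \<le> 2 * (\<bar>b\<bar> + 3 * c) / (c - b\<^sup>2 / (4 * a))\<^sup>2 / k ^ 3"
proof -
  define B where "B = (\<bar>b\<bar> + 3 * c) / (c - b\<^sup>2 / (4 * a))\<^sup>2 / k ^ 3"
  have "\<bar>1 / (a * x\<^sup>2 + b * x * y + c * y\<^sup>2) - 1 / (a * x\<^sup>2 + b * x * k + c * k\<^sup>2)\<bar> \<le> B"
    unfolding B_def using assms by (intro inverse_form_diff_bound)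
  moreover have "\<bar>1 / (a * x\<^sup>2 - b * x * y + c * y\<^sup>2) - 1 / (a * x\<^sup>2 - b * x * k + c * k\<^sup>2)\<bar> \<le> B"
    using inverse_form_diff_bound[of a c "-b" k x y] assms by (simp add: B_def)
  moreover have "2 * (\<bar>b\<bar> + 3 * c) / (c - b\<^sup>2 / (4 * a))\<^sup>2 / k ^ 3 = 2 * B"
    by (simp add: B_def)
  ultimately show ?thesis
    unfolding form_pair_def by linarith
qed

lemma inverse_cube_le_telescope:
  assumes "k > 0"
  shows "1 / real k ^ 3 \<le> 2 * (1 / (real k)\<^sup>2) - 2 * (1 / (real (Suc k))\<^sup>2)"
proof -
  define x where "x = real k"
  have x: "x \<ge> 1" using assms by (simp add: x_def)
  have "2 * (1 / x\<^sup>2) - 2 * (1 / (x + 1)\<^sup>2) - 1 / x ^ 3 = (3 * x\<^sup>2 - 1) / (x ^ 3 * (x + 1)\<^sup>2)"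
    using x by (simp add: divide_simps) (simp add: power2_eq_square power3_eq_cube algebra_simps)
  moreover have "(3 * x\<^sup>2 - 1) / (x ^ 3 * (x + 1)\<^sup>2) \<ge> 0"
  proof (rule divide_nonneg_nonneg)
    show "3 * x\<^sup>2 - 1 \<ge> 0" using one_le_power[OF x, of 2] by linarith
  qed (use x in auto)
  ultimately show ?thesis by (simp add: x_def add_ac)
qed

text \<open>The tail of the row differs from its integral by at most a multiple of the sum of k^(-3)
  over k \<ge> n. Since C depends neither on j nor on n, the rows j < n contribute O(1/n)
  altogether.\<close>

lemma row_tail_estimate:
  fixes a b c :: real
  assumes "a > 0" "c > 0" "b\<^sup>2 < 4 * a * c"
  obtains C where "C \<ge> 0" and "\<And>j n R. 0 < j \<Longrightarrow> j \<le> n \<Longrightarrow> (\<lambda>k. form_pair a b c (real j) (real (Suc k))) sums R \<Longrightarrow>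
     \<bar>(\<Sum>k = 1..<n. form_pair a b c (real j) (real k)) + strip_primitive a b c (real j / real n) / real j - R\<bar> \<le> C / (real n)\<^sup>2"
proof -
  define K where "K = 2 * (\<bar>b\<bar> + 3 * c) / (c - b\<^sup>2 / (4 * a))\<^sup>2"
  have K: "K \<ge> 0" using assms by (simp add: K_def)
  show ?thesis
  proof (rule that[of "2 * K"])
    fix j n :: nat and R :: real
    assume j: "0 < j" "j \<le> n" and R: "(\<lambda>k. form_pair a b c (real j) (real (Suc k))) sums R"
    define P where "P = (\<lambda>y. strip_primitive a b c (real j / y) / real j)"
    define X where "X = (\<lambda>n::nat. (\<Sum>k = 1..<n. form_pair a b c (real j) (real k)) + P (real n))"
    have P': "(P has_field_derivative - form_pair a b c (real j) y) (at y)" if "y > 0" for y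
    proof -
      define D where "D = 1 / (a * (j / y)\<^sup>2 + b * (j / y) + c) + 1 / (a * (j / y)\<^sup>2 - b * (j / y) + c)"
      have "((\<lambda>y. strip_primitive a b c (real j / y)) has_field_derivative D * (- real j / y\<^sup>2)) (at y)"
        unfolding D_def using assms that
        by (intro DERIV_chain2[where f = "strip_primitive a b c", OF has_field_derivative_strip_primitive])
           (auto intro!: derivative_eq_intros simp: power2_eq_square)
      hence "(P has_field_derivative D * (- real j / y\<^sup>2) / real j) (at y)"
        unfolding P_def by (rule DERIV_cdivide)
      also have "D * (- real j / y\<^sup>2) / real j = - (D / y\<^sup>2)" using j by simp
      also have "D / y\<^sup>2 = form_pair a b c (real j) y"
      proof -
        have *: "(a * (j / y)\<^sup>2 + b' * (j / y) + c) * y\<^sup>2 = a * (real j)\<^sup>2 + b' * real j * y + c * y\<^sup>2" for b'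
          using that by (simp add: field_simps power2_eq_square)
        show ?thesis
          unfolding D_def form_pair_def add_divide_distrib divide_divide_eq_left
          using *[of b] *[of "-b"] by simp
      qed
      finally show ?thesis .
    qed
    have "\<bar>X n - R\<bar> \<le> 2 * K * (1 / (real n)\<^sup>2)"
    proof (rule telescoping_bound_limit[where h = "\<lambda>k. 2 * K * (1 / (real k)\<^sup>2)"])
      have "isCont (strip_primitive a b c) 0"
        using has_field_derivative_strip_primitive assms DERIV_isCont by blast
      moreover have "(\<lambda>n. real j / real n) \<longlonglongrightarrow> 0" by real_asymp
      ultimately have "(\<lambda>n. strip_primitive a b c (real j / real n)) \<longlonglongrightarrow> strip_primitive a b c 0"
        by (rule isCont_tendsto_compose)
      hence "(\<lambda>n. P (real n)) \<longlonglongrightarrow> 0"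
        unfolding P_def by (intro tendsto_divide_zero) simp
      thus "X \<longlonglongrightarrow> R"
        unfolding X_def
        using tendsto_add[OF sums_imp_LIMSEQ_from_1[where u = "\<lambda>k. form_pair a b c (real j) (real k)", OF R], of "\<lambda>n. P (real n)" 0]
        by simp
      fix k :: nat assume "n \<le> k"
      hence k: "k > 0" "j \<le> k" using j by auto
      \<comment> \<open>The integral over [k, k + 1] is the value of the pair at some z in between,
        so an increment of X compares two values of the pair at distance less than 1.\<close>
      have "\<exists>z>real k. z < real (Suc k) \<and> P (real (Suc k)) - P (real k) = (real (Suc k) - real k) * (- form_pair a b c (real j) z)"
        using k by (intro MVT2 P') auto
      then obtain z where z: "real k < z" "z < real (Suc k)" "P (real (Suc k)) - P (real k) = - form_pair a b c (real j) z"
        by auto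
      have "X (Suc k) - X k = form_pair a b c (real j) (real k) - form_pair a b c (real j) z"
        using k z(3) by (simp add: X_def)
      also have "\<bar>\<dots>\<bar> \<le> K / real k ^ 3"
        unfolding K_def using form_pair_diff_bound[of a c b "real k" "real j" z] assms k z
        by (simp add: abs_minus_commute)
      also have "\<dots> = K * (1 / real k ^ 3)" by simp
      also have "\<dots> \<le> K * (2 * (1 / (real k)\<^sup>2) - 2 * (1 / (real (Suc k))\<^sup>2))"
        using inverse_cube_le_telescope[OF k(1)] K by (rule mult_left_mono)
      finally show "\<bar>X (Suc k) - X k\<bar> \<le> 2 * K * (1 / (real k)\<^sup>2) - 2 * K * (1 / (real (Suc k))\<^sup>2)"
        by (simp only: algebra_simps)
    qed (use K in auto)
    thus "\<bar>(\<Sum>k = 1..<n. form_pair a b c (real j) (real k)) + strip_primitive a b c (real j / real n) / real j - R\<bar> \<le> 2 * K / (real n)\<^sup>2"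
      by (simp add: X_def P_def)
  qed (use K in auto)
qed

lemma bqf_sum_eq: "bqf_sum a b c n = (\<Sum>j = 1..<n. \<Sum>k = 1..<n. form_pair a b c (real j) (real k))"
proof -
  have "{1..n - 1} = {1..<n}" by auto
  thus ?thesis by (simp add: bqf_sum_def form_pair_def)
qed

lemma bqf_sum_limit:
  fixes a b c :: real
  assumes "a > 0" "c > 0" "b\<^sup>2 < 4 * a * c"
  defines "s \<equiv> sqrt (4 * a * c - b\<^sup>2)"
  shows "(\<lambda>n. bqf_sum a b c n - 2 * pi / s * ln (real n)) \<longlonglongrightarrow>
     2 * pi / s * euler_mascheroni - pi\<^sup>2 / 6 * (1 / a + 1 / c) - 4 * pi / s * ln (cmod (dedekind_eta (bqf_mu a b c)))
      + 1 / s * ((pi / 2 - arctan ((c - a) / s)) * ln (c / a) - bqf_clausen a b c)"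
proof -
  have s: "s > 0" using assms by (simp add: s_def)
  define q where "q = nome a b c"
  define U where "U = (\<lambda>j. Re (q ^ j / (1 - q ^ j)) / real j)"
  define R where "R = (\<lambda>j. 2 * pi / s * (1 / real j) + 4 * pi / s * U j - 1 / (a * (real j)\<^sup>2))"
  define g where "g = strip_primitive a b c"
  define lP where "lP = ln (cmod (\<Prod>k. 1 - q ^ Suc k))"
  obtain C where C: "C \<ge> 0" "\<And>j n R. 0 < j \<Longrightarrow> j \<le> n \<Longrightarrow> (\<lambda>k. form_pair a b c (real j) (real (Suc k))) sums R \<Longrightarrow>
     \<bar>(\<Sum>k = 1..<n. form_pair a b c (real j) (real k)) + g (real j / real n) / real j - R\<bar> \<le> C / (real n)\<^sup>2"
    unfolding g_def using row_tail_estimate[OF assms(1-3)] by blast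
  define E where "E = (\<lambda>n. \<Sum>j = 1..<n. (\<Sum>k = 1..<n. form_pair a b c (real j) (real k)) + g (real j / real n) / real j - R j)"
  have "E \<longlonglongrightarrow> 0"
  proof (rule Lim_null_comparison)
    show "(\<lambda>n. C / real n) \<longlonglongrightarrow> 0" by real_asymp
    have "norm (E n) \<le> C / real n" if "n > 0" for n
    proof -
      have "norm (E n) \<le> (\<Sum>j = 1..<n. C / (real n)\<^sup>2)"
        unfolding E_def
      proof (rule sum_norm_le)
        fix j assume j: "j \<in> {1..<n}"
        have "(\<lambda>k. form_pair a b c (real j) (real (Suc k))) sums R j"
          using row_sum[of a c b j] assms j unfolding R_def U_def q_def s_def by simp
        thus "norm ((\<Sum>k = 1..<n. form_pair a b c (real j) (real k)) + g (real j / real n) / real j - R j) \<le> C / (real n)\<^sup>2"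
          using C(2)[of j n "R j"] j by simp
      qed
      also have "\<dots> \<le> real n * (C / (real n)\<^sup>2)"
        using C(1) by (auto intro!: divide_right_mono mult_right_mono)
      also have "\<dots> = C / real n" using that by (simp add: power2_eq_square)
      finally show ?thesis .
    qed
    thus "\<forall>\<^sub>F n in sequentially. norm (E n) \<le> C / real n"
      by (rule eventually_mono[OF eventually_gt_at_top[of 0]])
  qed
  moreover have "(\<lambda>n. (\<Sum>j = 1..<n. 1 / real j) - ln (real n)) \<longlonglongrightarrow> euler_mascheroni"
  proof -
    have lim: "(\<lambda>n. (harm n - ln (real n)) - 1 / real n) \<longlonglongrightarrow> (euler_mascheroni :: real) - 0"
      by (intro tendsto_diff euler_mascheroni_LIMSEQ) real_asymp
    have *: "(harm n - ln (real n)) - 1 / real n = (\<Sum>j = 1..<n. 1 / real j) - ln (real n)" if "n > 0" for n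
    proof -
      have "{1..n} = insert n {1..<n}" using that by auto
      thus ?thesis by (simp add: harm_def inverse_eq_divide)
    qed
    have "\<forall>\<^sub>F n in sequentially. (harm n - ln (real n)) - 1 / real n = (\<Sum>j = 1..<n. 1 / real j) - ln (real n)"
      by (rule eventually_mono[OF eventually_gt_at_top[of 0] *])
    from Lim_transform_eventually[OF lim this] show ?thesis by simp
  qed
  moreover have "(\<lambda>n. \<Sum>j = 1..<n. U j) \<longlonglongrightarrow> - lP"
    unfolding U_def lP_def q_def using assms
    by (intro sums_imp_LIMSEQ_from_1 lambert_series_eta cmod_nome_less_1)
  moreover have "(\<lambda>n. \<Sum>j = 1..<n. 1 / (real j)\<^sup>2) \<longlonglongrightarrow> pi\<^sup>2 / 6"
    using inverse_squares_sums by (intro sums_imp_LIMSEQ_from_1) (simp add: add_ac)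
  moreover have "(\<lambda>n. \<Sum>j = 1..<n. g (real j / real n) / real j) \<longlonglongrightarrow>
     (bqf_clausen a b c - (pi / 2 - arctan ((c - a) / s)) * ln (c / a)) / s"
    unfolding g_def s_def using assms by (intro strip_riemann_sum_tendsto)
  ultimately have "(\<lambda>n. E n + 2 * pi / s * ((\<Sum>j = 1..<n. 1 / real j) - ln (real n)) + 4 * pi / s * (\<Sum>j = 1..<n. U j)
       - 1 / a * (\<Sum>j = 1..<n. 1 / (real j)\<^sup>2) - (\<Sum>j = 1..<n. g (real j / real n) / real j)) \<longlonglongrightarrow>
     0 + 2 * pi / s * euler_mascheroni + 4 * pi / s * (- lP) - 1 / a * (pi\<^sup>2 / 6)
       - (bqf_clausen a b c - (pi / 2 - arctan ((c - a) / s)) * ln (c / a)) / s"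
    by (intro tendsto_intros)
  moreover have "E n + 2 * pi / s * ((\<Sum>j = 1..<n. 1 / real j) - ln (real n)) + 4 * pi / s * (\<Sum>j = 1..<n. U j)
       - 1 / a * (\<Sum>j = 1..<n. 1 / (real j)\<^sup>2) - (\<Sum>j = 1..<n. g (real j / real n) / real j) =
       bqf_sum a b c n - 2 * pi / s * ln (real n)" for n
  proof -
    have "(\<Sum>j = 1..<n. R j) = 2 * pi / s * (\<Sum>j = 1..<n. 1 / real j) + 4 * pi / s * (\<Sum>j = 1..<n. U j)
       - 1 / a * (\<Sum>j = 1..<n. 1 / (real j)\<^sup>2)"
      unfolding R_def sum_subtractf sum.distrib sum_distrib_left by simp
    thus ?thesis
      unfolding E_def bqf_sum_eq sum_subtractf sum.distrib by (simp add: right_diff_distrib)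
  qed
  moreover have "0 + 2 * pi / s * euler_mascheroni + 4 * pi / s * (- lP) - 1 / a * (pi\<^sup>2 / 6)
       - (bqf_clausen a b c - (pi / 2 - arctan ((c - a) / s)) * ln (c / a)) / s =
     2 * pi / s * euler_mascheroni - pi\<^sup>2 / 6 * (1 / a + 1 / c) - 4 * pi / s * ln (cmod (dedekind_eta (bqf_mu a b c)))
      + 1 / s * ((pi / 2 - arctan ((c - a) / s)) * ln (c / a) - bqf_clausen a b c)"
  proof -
    have "ln (cmod (dedekind_eta (bqf_mu a b c))) = lP - pi * s / (24 * c)"
      unfolding lP_def q_def s_def using assms by (intro ln_cmod_dedekind_eta)
    \<comment> \<open>The rows yield -pi^2/(6 a) alone; completing the product to eta introduces
      pi^2/(6 c), which the stated constant subtracts again.\<close>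
    moreover have "4 * pi / s * (lP - pi * s / (24 * c)) = 4 * pi / s * lP - pi\<^sup>2 / 6 * (1 / c)"
      using s assms by (simp add: field_simps power2_eq_square)
    ultimately have eta: "4 * pi / s * ln (cmod (dedekind_eta (bqf_mu a b c))) = 4 * pi / s * lP - pi\<^sup>2 / 6 * (1 / c)"
      by (simp only:)
    show ?thesis
      unfolding eta by (simp add: diff_divide_distrib distrib_left)
  qed
  ultimately show ?thesis by (simp only:)
qed

section \<open>Euler-Maclaurin on an edge of the square\<close>

text \<open>A bound on the whole line makes the location of the intermediate point irrelevant. The
  base index k lets one statement serve the primitive, the integrand and its derivative.\<close>

lemma taylor_remainder_bound:
  fixes D :: "nat \<Rightarrow> real \<Rightarrow> real"
  assumes D: "\<And>m t. (D m has_field_derivative D (Suc m) t) (at t)"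
    and M: "\<And>t. \<bar>D (k + n) t\<bar> \<le> M" and h: "h \<ge> 0"
  shows "\<bar>D k (x + h) - (\<Sum>m<n. D (k + m) x / fact m * h ^ m)\<bar> \<le> M * h ^ n / fact n"
proof -
  have "\<forall>m u. ((\<lambda>u. D (k + m) (x + u)) has_field_derivative D (k + Suc m) (x + u)) (at u)"
  proof (intro allI)
    fix m u
    show "((\<lambda>u. D (k + m) (x + u)) has_field_derivative D (k + Suc m) (x + u)) (at u)"
    proof -
      have "((\<lambda>u. x + u) has_field_derivative 1) (at u)" by (auto intro!: derivative_eq_intros)
      from DERIV_chain2[where f = "D (k + m)", OF D this] show ?thesis by simp
    qed
  qed
  then obtain t where t: "D k (x + h) = (\<Sum>m<n. D (k + m) x / fact m * h ^ m) + D (k + n) (x + t) / fact n * h ^ n"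
    using Maclaurin_all_le[of "\<lambda>m u. D (k + m) (x + u)" "\<lambda>u. D k (x + u)" h n] by auto
  have "\<bar>D (k + n) (x + t)\<bar> * h ^ n / fact n \<le> M * h ^ n / fact n"
    using M h by (intro divide_right_mono mult_right_mono) auto
  thus ?thesis unfolding t using h by (simp add: abs_mult)
qed

text \<open>\<open>D 0\<close> is the primitive and \<open>D 1\<close> the integrand. With the
  weights 1/2 and 1/12 all Taylor terms up to h^4 cancel, and the three remainders contribute at
  most 1/120, 1/48 and 1/72 of M h^5.\<close>

lemma corrected_trapezoid_step:
  fixes D :: "nat \<Rightarrow> real \<Rightarrow> real"
  assumes D: "\<And>m t. (D m has_field_derivative D (Suc m) t) (at t)"
    and M: "\<And>t. \<bar>D 5 t\<bar> \<le> M" and h: "h \<ge> 0"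
  shows "\<bar>D 0 (x + h) - D 0 x - h / 2 * (D 1 x + D 1 (x + h)) + h\<^sup>2 / 12 * (D 2 (x + h) - D 2 x)\<bar> \<le> M * h ^ 5"
proof -
  define r0 r1 r2 where "r0 = D 0 (x + h) - (\<Sum>m<5. D (0 + m) x / fact m * h ^ m)"
    and "r1 = D 1 (x + h) - (\<Sum>m<4. D (1 + m) x / fact m * h ^ m)"
    and "r2 = D 2 (x + h) - (\<Sum>m<3. D (2 + m) x / fact m * h ^ m)"
  have "\<bar>r0\<bar> \<le> M * h ^ 5 / fact 5" "\<bar>r1\<bar> \<le> M * h ^ 4 / fact 4" "\<bar>r2\<bar> \<le> M * h ^ 3 / fact 3"
    unfolding r0_def r1_def r2_def by (intro taylor_remainder_bound D h; use M in simp)+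
  hence r: "\<bar>r0\<bar> \<le> M * h ^ 5 / 120" "\<bar>r1\<bar> \<le> M * h ^ 4 / 24" "\<bar>r2\<bar> \<le> M * h ^ 3 / 6"
    by (simp_all add: fact_numeral)
  have "D 0 (x + h) - D 0 x - h / 2 * (D 1 x + D 1 (x + h)) + h\<^sup>2 / 12 * (D 2 (x + h) - D 2 x)
     = r0 - h / 2 * r1 + h\<^sup>2 / 12 * r2"
    unfolding r0_def r1_def r2_def
    by (simp add: eval_nat_numeral fact_numeral) (simp add: field_simps)
  also have "\<bar>\<dots>\<bar> \<le> \<bar>r0\<bar> + h / 2 * \<bar>r1\<bar> + h\<^sup>2 / 12 * \<bar>r2\<bar>"
    using h abs_triangle_ineq4[of r0 "h / 2 * r1"] abs_triangle_ineq[of "r0 - h / 2 * r1" "h\<^sup>2 / 12 * r2"]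
    by (simp add: abs_mult)
  also have "\<dots> \<le> M * h ^ 5 / 120 + h / 2 * (M * h ^ 4 / 24) + h\<^sup>2 / 12 * (M * h ^ 3 / 6)"
    using r h by (intro add_mono mult_left_mono) auto
  also have "\<dots> = M * h ^ 5 * (1 / 120 + 1 / 48 + 1 / 72)"
    by (simp add: eval_nat_numeral algebra_simps)
  also have "\<dots> \<le> M * h ^ 5 * 1"
  proof (rule mult_left_mono)
    have "M \<ge> 0" using M[of 0] by linarith
    thus "M * h ^ 5 \<ge> 0" using h by simp
  qed simp
  finally show ?thesis by simp
qed

text \<open>Each of the n steps of length 1/n has an error of at most M / n^5. Only right end points
  are summed, hence the positive sign of the correction by D 1.\<close>

lemma euler_maclaurin_unit_interval:
  fixes D :: "nat \<Rightarrow> real \<Rightarrow> real"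
  assumes D: "\<And>m t. (D m has_field_derivative D (Suc m) t) (at t)"
    and M: "\<And>t. \<bar>D 5 t\<bar> \<le> M" and n: "n > 0"
  shows "\<bar>(\<Sum>k = 1..n. D 1 (real k / real n)) / real n -
     (D 0 1 - D 0 0 + (D 1 1 - D 1 0) / (2 * real n) + (D 2 1 - D 2 0) / (12 * (real n)\<^sup>2))\<bar> \<le> M / real n ^ 4"
proof -
  define h where "h = 1 / real n"
  have h: "h \<ge> 0" using n by (simp add: h_def)
  define T where "T = (\<lambda>k. D 0 (real (Suc k) * h) - D 0 (real k * h) - h / 2 * (D 1 (real k * h) + D 1 (real (Suc k) * h))
     + h\<^sup>2 / 12 * (D 2 (real (Suc k) * h) - D 2 (real k * h)))"
  have "\<bar>T k\<bar> \<le> M * h ^ 5" for k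
    using corrected_trapezoid_step[OF D M h, of "real k * h"] by (simp add: T_def distrib_right add_ac)
  hence "\<bar>\<Sum>k<n. T k\<bar> \<le> (\<Sum>k<n. M * h ^ 5)"
    by (intro order_trans[OF sum_abs] sum_mono)
  also have "\<dots> = M / real n ^ 4"
    using n by (simp add: h_def power_divide eval_nat_numeral)
  finally have bound: "\<bar>\<Sum>k<n. T k\<bar> \<le> M / real n ^ 4" .
  have tele: "(\<Sum>k<n. F (real (Suc k) * h) - F (real k * h)) = F 1 - F 0" for F :: "real \<Rightarrow> real"
    using sum_lessThan_telescope[of "\<lambda>k. F (real k * h)" n] n by (simp add: h_def)
  have shift: "(\<Sum>k<n. D 1 (real (Suc k) * h)) = (\<Sum>k = 1..n. D 1 (real k * h))"
    by (simp add: sum.atLeast1_atMost_eq)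
  have "(\<Sum>k<n. D 1 (real k * h)) = (\<Sum>k<n. D 1 (real (Suc k) * h)) - (D 1 1 - D 1 0)"
    using tele[of "D 1"] by (simp add: sum_subtractf)
  hence mid: "(\<Sum>k<n. D 1 (real k * h)) + (\<Sum>k<n. D 1 (real (Suc k) * h)) = 2 * (\<Sum>k = 1..n. D 1 (real k * h)) - (D 1 1 - D 1 0)"
    unfolding shift by simp
  have "(\<Sum>k<n. T k) = (D 0 1 - D 0 0) - h / 2 * (2 * (\<Sum>k = 1..n. D 1 (real k * h)) - (D 1 1 - D 1 0))
      + h\<^sup>2 / 12 * (D 2 1 - D 2 0)"
    unfolding T_def sum.distrib sum_subtractf[of "\<lambda>k. D 0 (real (Suc k) * h) - D 0 (real k * h)"]
      sum_distrib_left[symmetric] tele mid ..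
  also have "\<dots> = - ((\<Sum>k = 1..n. D 1 (real k / real n)) / real n -
     (D 0 1 - D 0 0 + (D 1 1 - D 1 0) / (2 * real n) + (D 2 1 - D 2 0) / (12 * (real n)\<^sup>2)))"
    using n by (simp add: h_def power_divide field_simps)
  finally show ?thesis using bound by simp
qed

text \<open>The inverse polynomial is (2/s) Im (1/(t - \<rho>)) for its root \<rho> in the upper
  half-plane. This gives all derivatives in closed form, and |t - \<rho>| \<ge> Im \<rho> bounds
  them on the whole line.\<close>

lemma inverse_quadratic_derivatives:
  fixes a b c :: real
  assumes "a > 0" "b\<^sup>2 < 4 * a * c"
  defines "s \<equiv> sqrt (4 * a * c - b\<^sup>2)"
  obtains D :: "nat \<Rightarrow> real \<Rightarrow> real" and M
  where "\<And>t. D 0 t = 2 / s * arctan ((2 * a * t + b) / s)"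
    and "\<And>t. D 1 t = 1 / (a * t\<^sup>2 + b * t + c)"
    and "\<And>t. D 2 t = - (2 * a * t + b) / (a * t\<^sup>2 + b * t + c)\<^sup>2"
    and "\<And>m t. (D m has_field_derivative D (Suc m) t) (at t)"
    and "\<And>t. \<bar>D 5 t\<bar> \<le> M"
proof -
  have s: "s > 0" "s\<^sup>2 = 4 * a * c - b\<^sup>2" using assms by (auto simp: s_def)
  define \<rho> where "\<rho> = Complex (- b / (2 * a)) (s / (2 * a))"
  have Im: "Im \<rho> > 0" using s assms by (simp add: \<rho>_def)
  have ne: "of_real t - \<rho> \<noteq> 0" for t
    using Im by (auto simp: complex_eq_iff)
  define E where "E = (\<lambda>m z. (-1) ^ m * fact m / (z - \<rho>) ^ Suc m)"
  \<comment> \<open>The index is shifted by one: \<open>D 0\<close> is the arctangent primitive, and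
    \<open>E 0\<close> belongs to the integrand.\<close>
  define D where "D = (\<lambda>m t. if m = 0 then 2 / s * arctan ((2 * a * t + b) / s) else 2 / s * Im (E (m - 1) (of_real t)))"
  have q: "a * t\<^sup>2 + b * t + c > 0" for t using quadratic_pos assms by blast
  have D1: "D 1 t = 1 / (a * t\<^sup>2 + b * t + c)" for t
  proof -
    have "a * ((Re (of_real t - \<rho>))\<^sup>2 + (Im (of_real t - \<rho>))\<^sup>2) = a * t\<^sup>2 + b * t + (b\<^sup>2 + s\<^sup>2) / (4 * a)"
      using assms(1) by (simp add: \<rho>_def field_simps power2_eq_square)
    also have "\<dots> = a * t\<^sup>2 + b * t + c" unfolding s using assms by simp
    finally have eq: "(Re (of_real t - \<rho>))\<^sup>2 + (Im (of_real t - \<rho>))\<^sup>2 = (a * t\<^sup>2 + b * t + c) / a"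
      using assms(1) by (simp add: field_simps)
    have "Im (1 / (of_real t - \<rho>)) = Im \<rho> / ((Re (of_real t - \<rho>))\<^sup>2 + (Im (of_real t - \<rho>))\<^sup>2)"
      unfolding Im_divide by simp
    also have "\<dots> = s / 2 / (a * t\<^sup>2 + b * t + c)"
      unfolding eq using assms(1) by (simp add: \<rho>_def)
    finally have "D 1 t = 2 / s * (s / 2 / (a * t\<^sup>2 + b * t + c))" by (simp add: D_def E_def)
    moreover have "2 / s * (s / 2 / x) = 1 / x" for x using s by simp
    ultimately show ?thesis by (simp only:)
  qed
  have DSuc: "(D m has_field_derivative D (Suc m) t) (at t)" for m t
  proof (cases m)
    case 0
    have "(D 0 has_field_derivative 2 / s * (s / 2 / (a * t\<^sup>2 + b * t + c))) (at t)"
    proof -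
      have "D 0 = (\<lambda>t. 2 / s * arctan ((2 * a * t + b) / s))" by (simp add: D_def fun_eq_iff)
      thus ?thesis
        unfolding s_def using has_field_derivative_arctan_quadratic[OF assms(1,2)]
        by (simp only: DERIV_cmult)
    qed
    moreover have "2 / s * (s / 2 / x) = 1 / x" for x using s by simp
    ultimately show ?thesis using 0 D1[of t] by (simp only: One_nat_def)
  next
    case (Suc k)
    have "(E k has_field_derivative E (Suc k) (of_real t)) (at (of_real t))"
    proof -
      have "((\<lambda>z. (-1) ^ k * fact k * inverse (z - \<rho>) ^ Suc k) has_field_derivative
         (-1) ^ k * fact k * (of_nat (Suc k) * inverse (of_real t - \<rho>) ^ k * (- (inverse (of_real t - \<rho>) ^ 2)))) (at (of_real t))"
        using ne[of t] by (auto intro!: derivative_eq_intros simp: power2_eq_square simp del: of_nat_Suc power_Suc)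
      moreover have "(-1) ^ k * fact k * (of_nat (Suc k) * inverse (of_real t - \<rho>) ^ k * (- (inverse (of_real t - \<rho>) ^ 2))) = E (Suc k) (of_real t)"
        by (simp add: E_def divide_inverse power_inverse power2_eq_square mult_ac)
      moreover have "E k = (\<lambda>z. (-1) ^ k * fact k * inverse (z - \<rho>) ^ Suc k)"
        by (simp add: E_def divide_inverse power_inverse)
      ultimately show ?thesis by simp
    qed
    hence "((\<lambda>t. E k (of_real t)) has_vector_derivative E (Suc k) (of_real t)) (at t)"
      by (rule has_vector_derivative_real_field)
    hence "((\<lambda>t. Im (E k (of_real t))) has_vector_derivative Im (E (Suc k) (of_real t))) (at t)"
      by (rule bounded_linear.has_vector_derivative[OF bounded_linear_Im])
    hence "((\<lambda>t. Im (E k (of_real t))) has_field_derivative Im (E (Suc k) (of_real t))) (at t)"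
      by (simp add: has_real_derivative_iff_has_vector_derivative)
    hence "((\<lambda>t. 2 / s * Im (E k (of_real t))) has_field_derivative 2 / s * Im (E (Suc k) (of_real t))) (at t)"
      by (rule DERIV_cmult)
    thus ?thesis using Suc by (simp add: D_def)
  qed
  have "D 2 t = - (2 * a * t + b) / (a * t\<^sup>2 + b * t + c)\<^sup>2" for t
  proof (rule DERIV_unique)
    show "(D 1 has_field_derivative D 2 t) (at t)" using DSuc[of 1 t] by (simp add: numeral_2_eq_2)
    have "((\<lambda>t. 1 / (a * t\<^sup>2 + b * t + c)) has_field_derivative - (2 * a * t + b) / (a * t\<^sup>2 + b * t + c)\<^sup>2) (at t)"
      using q[of t] by (auto intro!: derivative_eq_intros simp: power2_eq_square)
    thus "(D 1 has_field_derivative - (2 * a * t + b) / (a * t\<^sup>2 + b * t + c)\<^sup>2) (at t)"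
      unfolding D1[abs_def, symmetric] .
  qed
  moreover have "\<bar>D 5 t\<bar> \<le> 2 / s * (fact 4 / Im \<rho> ^ 5)" for t
  proof -
    have "Im \<rho> \<le> cmod (of_real t - \<rho>)"
      using abs_Im_le_cmod[of "of_real t - \<rho>"] Im by simp
    hence "fact 4 / cmod (of_real t - \<rho>) ^ 5 \<le> fact 4 / Im \<rho> ^ 5"
      using Im by (intro frac_le power_mono) auto
    moreover have "cmod (E 4 (of_real t)) = fact 4 / cmod (of_real t - \<rho>) ^ 5"
    proof -
      have "Suc 4 = (5 :: nat)" by simp
      thus ?thesis unfolding E_def by (simp only: norm_divide norm_power norm_mult) simp
    qed
    ultimately have "\<bar>Im (E 4 (of_real t))\<bar> \<le> fact 4 / Im \<rho> ^ 5"
      using abs_Im_le_cmod[of "E 4 (of_real t)"] by linarith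
    hence "2 / s * \<bar>Im (E 4 (of_real t))\<bar> \<le> 2 / s * (fact 4 / Im \<rho> ^ 5)"
      using s by (intro mult_left_mono) auto
    thus ?thesis using s by (simp add: D_def abs_mult)
  qed
  ultimately show ?thesis
    using that[of D "2 / s * (fact 4 / Im \<rho> ^ 5)"] D1 DSuc by (simp add: D_def)
qed

text \<open>By homogeneity the edge is n^(-2) times a sum of 1/(c t^2 + b t + a) at t = k/n, so a
  and c change places in the polynomial. There is no n^(-4) term because the corresponding Bernoulli
  number B_3 is zero.\<close>

lemma edge_sum_expansion:
  fixes a b c :: real
  assumes "c > 0" "b\<^sup>2 < 4 * a * c"
  defines "s \<equiv> sqrt (4 * a * c - b\<^sup>2)"
  shows "(\<lambda>n. (\<Sum>k = 1..n. 1 / (a * (real n)\<^sup>2 + b * real n * real k + c * (real k)\<^sup>2)) -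
     (2 / s * (arctan ((2 * c + b) / s) - arctan (b / s)) / real n
      + (1 / (a + b + c) - 1 / a) / 2 / real n ^ 2
      + (b / a\<^sup>2 - (2 * c + b) / (a + b + c)\<^sup>2) / 12 / real n ^ 3)) \<in> O(\<lambda>n. 1 / real n ^ 5)"
proof -
  obtain D M where D: "\<And>t. D 0 t = 2 / s * arctan ((2 * c * t + b) / s)"
    "\<And>t. D 1 t = 1 / (c * t\<^sup>2 + b * t + a)"
    "\<And>t. D 2 t = - (2 * c * t + b) / (c * t\<^sup>2 + b * t + a)\<^sup>2"
    "\<And>m t. (D m has_field_derivative D (Suc m) t) (at t)"
    "\<And>t. \<bar>D 5 t\<bar> \<le> M"
    using inverse_quadratic_derivatives[of c b a] assms by (auto simp: mult_ac)
  define F where "F = (\<lambda>n. (\<Sum>k = 1..n. 1 / (a * (real n)\<^sup>2 + b * real n * real k + c * (real k)\<^sup>2)) -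
     (2 / s * (arctan ((2 * c + b) / s) - arctan (b / s)) / real n
      + (1 / (a + b + c) - 1 / a) / 2 / real n ^ 2
      + (b / a\<^sup>2 - (2 * c + b) / (a + b + c)\<^sup>2) / 12 / real n ^ 3))"
  have bd: "norm (F n) \<le> M * norm (1 / real n ^ 5)" if n: "n > 0" for n :: nat
  proof -
    have "(\<Sum>k = 1..n. 1 / (a * (real n)\<^sup>2 + b * real n * real k + c * (real k)\<^sup>2)) = (\<Sum>k = 1..n. D 1 (real k / real n)) / (real n)\<^sup>2"
      unfolding sum_divide_distrib
    proof (rule sum.cong)
      fix k
      have "(c * (real k / real n)\<^sup>2 + b * (real k / real n) + a) * (real n)\<^sup>2 = a * (real n)\<^sup>2 + b * real n * real k + c * (real k)\<^sup>2"
        using n by (simp add: field_simps power2_eq_square)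
      thus "1 / (a * (real n)\<^sup>2 + b * real n * real k + c * (real k)\<^sup>2) = D 1 (real k / real n) / (real n)\<^sup>2"
        unfolding D by simp
    qed simp
    moreover have "D 0 1 - D 0 0 = 2 / s * (arctan ((2 * c + b) / s) - arctan (b / s))"
      by (simp add: D right_diff_distrib)
    moreover have split: "S / (real n)\<^sup>2 - (u / real n + v / 2 / real n ^ 2 + w / 12 / real n ^ 3) =
       (S / real n - (u + v / (2 * real n) + w / (12 * (real n)\<^sup>2))) / real n" for S u v w
      using n by (simp add: diff_divide_distrib add_divide_distrib power2_eq_square power3_eq_cube mult_ac)
    moreover have "D 1 1 - D 1 0 = 1 / (a + b + c) - 1 / a"
      unfolding D by (simp add: add_ac)
    moreover have "D 2 1 - D 2 0 = b / a\<^sup>2 - (2 * c + b) / (a + b + c)\<^sup>2"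
      unfolding D minus_divide_left[symmetric] by (simp add: add_ac)
    ultimately have "F n = ((\<Sum>k = 1..n. D 1 (real k / real n)) / real n -
     (D 0 1 - D 0 0 + (D 1 1 - D 1 0) / (2 * real n) + (D 2 1 - D 2 0) / (12 * (real n)\<^sup>2))) / real n"
      using split unfolding F_def by (simp only:)
    also have "norm \<dots> \<le> M / real n ^ 4 / real n"
      unfolding real_norm_def abs_divide abs_of_nat
      by (intro divide_right_mono euler_maclaurin_unit_interval[OF D(4,5) n]) simp
    finally show ?thesis by (simp add: eval_nat_numeral)
  qed
  show ?thesis
    unfolding F_def[symmetric]
    by (rule bigoI[of _ M]) (rule eventually_mono[OF eventually_gt_at_top[of 0] bd])
qed

section \<open>The asymptotic expansion\<close>

text \<open>The new index pairs form two edges of the square that share the corner (n, n), hence the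
  subtraction.\<close>

lemma bqf_sum_Suc:
  assumes "n > 0"
  shows "bqf_sum a b c (Suc n) - bqf_sum a b c n =
    (\<Sum>k = 1..n. form_pair a b c (real n) (real k)) + (\<Sum>k = 1..n. form_pair a b c (real k) (real n))
     - form_pair a b c (real n) (real n)"
proof -
  let ?f = "\<lambda>j k. form_pair a b c (real j) (real k)"
  have ins: "{1..<Suc n} = insert n {1..<n}" "{1..n} = insert n {1..<n}" using assms by auto
  show ?thesis
    unfolding bqf_sum_eq ins by (simp add: sum.distrib)
qed

text \<open>Four edge expansions are added, for both signs of b and with a and c exchanged. The
  terms arctan (b/s) are odd in b and cancel, the other angles add up to pi, and the trapezoid
  corrections at the corner add up to p, exactly the doubly counted corner.\<close>

lemma bqf_sum_increment:
  fixes a b c :: real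
  assumes "a > 0" "c > 0" "b\<^sup>2 < 4 * a * c"
  defines "s \<equiv> sqrt (4 * a * c - b\<^sup>2)"
  defines "p \<equiv> 1 / (a - b + c) + 1 / (a + b + c)"
  shows "(\<lambda>n. bqf_sum a b c (Suc n) - bqf_sum a b c n
     - (2 * pi / s / real n - (1 / a + 1 / c) / real n ^ 2 - p / 6 / real n ^ 3)) \<in> O(\<lambda>n. 1 / real n ^ 5)"
proof -
  have s: "s > 0" using assms by (simp add: s_def)
  define A where "A = (\<lambda>c b. 2 / s * (arctan ((2 * c + b) / s) - arctan (b / s)))"
  define B :: "real \<Rightarrow> real \<Rightarrow> real \<Rightarrow> real" where "B = (\<lambda>a b c. (1 / (a + b + c) - 1 / a) / 2)"
  define C :: "real \<Rightarrow> real \<Rightarrow> real \<Rightarrow> real" where "C = (\<lambda>a b c. (b / a\<^sup>2 - (2 * c + b) / (a + b + c)\<^sup>2) / 12)"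
  define S :: "real \<Rightarrow> real \<Rightarrow> real \<Rightarrow> nat \<Rightarrow> real" where "S = (\<lambda>a b c n. \<Sum>k = 1..n. 1 / (a * (real n)\<^sup>2 + b * real n * real k + c * (real k)\<^sup>2))"
  define F where "F = (\<lambda>a b c n. S a b c n - (A c b / real n + B a b c / real n ^ 2 + C a b c / real n ^ 3))"
  have F: "F a b c \<in> O(\<lambda>n. 1 / real n ^ 5)" "F a (-b) c \<in> O(\<lambda>n. 1 / real n ^ 5)"
    "F c b a \<in> O(\<lambda>n. 1 / real n ^ 5)" "F c (-b) a \<in> O(\<lambda>n. 1 / real n ^ 5)"
    using edge_sum_expansion[of c b a] edge_sum_expansion[of c "-b" a]
      edge_sum_expansion[of a b c] edge_sum_expansion[of a "-b" c] assms(1-3)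
    unfolding F_def S_def A_def B_def C_def s_def by (simp_all add: mult_ac)
  have pos: "a + b + c > 0" "a - b + c > 0"
    using quadratic_pos[of a b c 1] quadratic_pos[of a "-b" c 1] assms by auto
  have "A c b + A c (-b) + A a b + A a (-b) = 2 / s * ((arctan ((2 * c + b) / s) + arctan ((2 * c - b) / s))
     + (arctan ((2 * a + b) / s) + arctan ((2 * a - b) / s)))"
    unfolding A_def by (simp add: arctan_minus algebra_simps)
  also have "\<dots> = 2 / s * (pi - (arctan ((a - c) / s) + arctan ((c - a) / s)))"
    using arctan_sum_complement[of a b c] arctan_sum_complement[of c b a] assms(1-3)
    by (simp add: s_def mult_ac)
  also have "arctan ((a - c) / s) + arctan ((c - a) / s) = 0"
    using arctan_minus[of "(a - c) / s"] by (simp add: minus_divide_left)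
  finally have A: "A c b + A c (-b) + A a b + A a (-b) = 2 * pi / s" by simp
  have B: "B a b c + B a (-b) c + B c b a + B c (-b) a - p = - (1 / a + 1 / c)"
  proof -
    have eqs: "a + - b + c = a - b + c" "c + b + a = a + b + c" "c + - b + a = a - b + c" by simp_all
    have "(P - x) / 2 + (Q - x) / 2 + (P - y) / 2 + (Q - y) / 2 - (Q + P) = - (x + y)" for P Q x y :: real
      by (simp add: field_simps)
    thus ?thesis unfolding B_def p_def eqs by this
  qed
  have C: "C a b c + C a (-b) c + C c b a + C c (-b) a = - p / 6"
  proof -
    have cancel: "2 * e / e\<^sup>2 = 2 / e" if "e \<noteq> 0" for e :: real
      using that by (simp add: power2_eq_square)
    \<comment> \<open>The two edges meeting at a corner have derivative numerators 2 c + x and 2 a +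
      x. Their sum is twice the value a + x + c of the form there, which cancels one power of the
      denominator.\<close>
    have q: "(2 * c + x) / (a + x + c)\<^sup>2 + (2 * a + x) / (c + x + a)\<^sup>2 = 2 / (a + x + c)"
      if "a + x + c \<noteq> 0" for x
    proof -
      have "(2 * c + x) / (a + x + c)\<^sup>2 + (2 * a + x) / (c + x + a)\<^sup>2 = ((2 * c + x) + (2 * a + x)) / (a + x + c)\<^sup>2"
        by (simp add: add_divide_distrib[symmetric] add_ac)
      also have "(2 * c + x) + (2 * a + x) = 2 * (a + x + c)" by simp
      also have "2 * (a + x + c) / (a + x + c)\<^sup>2 = 2 / (a + x + c)"
        by (rule cancel[OF that])
      finally show ?thesis .
    qed
    have "C a b c + C a (-b) c + C c b a + C c (-b) a =
      - (((2 * c + b) / (a + b + c)\<^sup>2 + (2 * a + b) / (c + b + a)\<^sup>2) + ((2 * c + - b) / (a + - b + c)\<^sup>2 + (2 * a + - b) / (c + - b + a)\<^sup>2)) / 12"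
      unfolding C_def by (simp add: add_divide_distrib diff_divide_distrib)
    also have "\<dots> = - (2 / (a + b + c) + 2 / (a + - b + c)) / 12"
      using q[of b] q[of "-b"] pos by simp
    also have "\<dots> = - p / 6" by (simp add: p_def add_divide_distrib add_ac)
    finally show ?thesis .
  qed
  have "F a b c n + F a (-b) c n + F c b a n + F c (-b) a n = bqf_sum a b c (Suc n) - bqf_sum a b c n
     - (2 * pi / s / real n - (1 / a + 1 / c) / real n ^ 2 - p / 6 / real n ^ 3)" if n: "n > 0" for n
  proof -
    have "S a b c n + S a (-b) c n = (\<Sum>k = 1..n. form_pair a b c (real n) (real k))"
      by (simp add: S_def form_pair_def sum.distrib)
    moreover have "S c b a n + S c (-b) a n = (\<Sum>k = 1..n. form_pair a b c (real k) (real n))"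
      by (simp add: S_def form_pair_def sum.distrib[symmetric] algebra_simps)
    moreover have "form_pair a b c (real n) (real n) = p / real n ^ 2"
    proof -
      have "a * (real n)\<^sup>2 + x * real n * real n + c * (real n)\<^sup>2 = (a + x + c) * (real n)\<^sup>2" for x
        by (simp add: algebra_simps power2_eq_square)
      from this[of b] this[of "-b"] show ?thesis
        by (simp add: form_pair_def p_def add_divide_distrib)
    qed
    ultimately have "bqf_sum a b c (Suc n) - bqf_sum a b c n = S a b c n + S a (-b) c n + S c b a n + S c (-b) a n - p / real n ^ 2"
      unfolding bqf_sum_Suc[OF n] by simp
    moreover have "F a b c n + F a (-b) c n + F c b a n + F c (-b) a n = S a b c n + S a (-b) c n + S c b a n + S c (-b) a n
      - ((A c b + A c (-b) + A a b + A a (-b)) / real n + (B a b c + B a (-b) c + B c b a + B c (-b) a) / real n ^ 2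
        + (C a b c + C a (-b) c + C c b a + C c (-b) a) / real n ^ 3)"
      unfolding F_def by (simp add: add_divide_distrib)
    moreover have "B a b c + B a (-b) c + B c b a + B c (-b) a = p - (1 / a + 1 / c)"
      using B by simp
    ultimately show ?thesis
      unfolding A C by (simp add: diff_divide_distrib)
  qed
  hence ev: "eventually (\<lambda>n. F a b c n + F a (-b) c n + F c b a n + F c (-b) a n = bqf_sum a b c (Suc n) - bqf_sum a b c n
     - (2 * pi / s / real n - (1 / a + 1 / c) / real n ^ 2 - p / 6 / real n ^ 3)) at_top"
    by (rule eventually_mono[OF eventually_gt_at_top[of 0]])
  have "(\<lambda>n. F a b c n + F a (-b) c n + F c b a n + F c (-b) a n) \<in> O(\<lambda>n. 1 / real n ^ 5)"
    by (intro sum_in_bigo F)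
  thus ?thesis
    by (rule landau_o.big.in_cong[OF ev, THEN iffD1])
qed

text \<open>The constant 2 is generous; it keeps the numerator of the difference nonnegative from k
  = 1 on.\<close>

lemma inverse_power5_le_telescope:
  assumes "k > 0"
  shows "1 / real k ^ 5 \<le> 2 * (1 / real k ^ 4) - 2 * (1 / real (Suc k) ^ 4)"
proof -
  define x where "x = real k"
  have x: "x \<ge> 1" using assms by (simp add: x_def)
  have "2 * (1 / x ^ 4) - 2 * (1 / (x + 1) ^ 4) - 1 / x ^ 5 = (7 * x ^ 4 + 8 * x ^ 3 + 2 * x\<^sup>2 - 2 * x - 1) / (x ^ 5 * (x + 1) ^ 4)"
    using x by (simp add: divide_simps) (simp add: eval_nat_numeral algebra_simps)
  moreover have "(7 * x ^ 4 + 8 * x ^ 3 + 2 * x\<^sup>2 - 2 * x - 1) / (x ^ 5 * (x + 1) ^ 4) \<ge> 0"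
  proof (rule divide_nonneg_nonneg)
    have "x ^ 1 \<le> x ^ 2" "1 \<le> x ^ 4" "1 \<le> x ^ 3"
      by (intro power_increasing one_le_power x; simp)+
    thus "7 * x ^ 4 + 8 * x ^ 3 + 2 * x\<^sup>2 - 2 * x - 1 \<ge> 0" by simp
  qed (use x in auto)
  ultimately show ?thesis by (simp add: x_def add_ac)
qed

text \<open>The limit is known independently, so the increments only have to supply the rate;
  summing n^(-5) from n onwards costs one power.\<close>

lemma bigo_limit_from_increments:
  fixes X :: "nat \<Rightarrow> real"
  assumes lim: "X \<longlonglongrightarrow> L" and incr: "(\<lambda>n. X (Suc n) - X n) \<in> O(\<lambda>n. 1 / real n ^ 5)"
  shows "(\<lambda>n. X n - L) \<in> O(\<lambda>n. 1 / real n ^ 4)"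
proof -
  obtain C where C: "C > 0" "eventually (\<lambda>n. norm (X (Suc n) - X n) \<le> C * norm (1 / real n ^ 5)) sequentially"
    using incr by (auto elim: landau_o.bigE)
  then obtain N where N: "\<And>n. n \<ge> N \<Longrightarrow> \<bar>X (Suc n) - X n\<bar> \<le> C * (1 / real n ^ 5)"
    by (auto simp: eventually_sequentially)
  have "\<bar>X n - L\<bar> \<le> 2 * C * (1 / real n ^ 4)" if n: "n \<ge> max N 1" for n
  proof (rule telescoping_bound_limit[where h = "\<lambda>k. 2 * C * (1 / real k ^ 4)", OF lim])
    fix k assume k: "n \<le> k"
    have "\<bar>X (Suc k) - X k\<bar> \<le> C * (1 / real k ^ 5)" using N k n by simp
    also have "\<dots> \<le> C * (2 * (1 / real k ^ 4) - 2 * (1 / real (Suc k) ^ 4))"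
      using C(1) k n by (intro mult_left_mono inverse_power5_le_telescope) auto
    finally show "\<bar>X (Suc k) - X k\<bar> \<le> 2 * C * (1 / real k ^ 4) - 2 * C * (1 / real (Suc k) ^ 4)"
      by (simp only: algebra_simps)
  qed (use C in auto)
  thus ?thesis
    by (intro bigoI[of _ "2 * C"] eventually_sequentiallyI[of "max N 1"]) auto
qed

theorem theorem3:
  fixes a b c d :: real
  assumes "bqf_pos_def a b c"
    and "d = bqf_disc a b c"
  shows "(\<lambda>n::nat. bqf_sum a b c n -
      (2 * pi / sqrt \<bar>d\<bar> * ln (real n)
       + (2 * pi / sqrt \<bar>d\<bar> * euler_mascheroni
          - pi\<^sup>2 / 6 * (1 / a + 1 / c)
          - 4 * pi / sqrt \<bar>d\<bar> * ln (cmod (dedekind_eta (bqf_mu a b c)))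
          + 1 / sqrt \<bar>d\<bar> *
              ((pi / 2 - arctan ((c - a) / sqrt \<bar>d\<bar>)) * ln (c / a) - bqf_clausen a b c))
       + (1 / a + 1 / c - pi / sqrt \<bar>d\<bar>) * (1 / real n)
       + (1 / 2 * (1 / a + 1 / c) + 1 / 12 * (1 / (a - b + c) + 1 / (a + b + c))
          - pi / (6 * sqrt \<bar>d\<bar>)) * (1 / real n ^ 2)
       + (1 / 6 * (1 / a + 1 / c) + 1 / 12 * (1 / (a - b + c) + 1 / (a + b + c)))
          * (1 / real n ^ 3)))
    \<in> O(\<lambda>n. ln (real n) / real n ^ 4)"
proof -
  have "bqf a b c 1 0 > 0" "bqf a b c 0 1 > 0"
    using assms(1) unfolding bqf_pos_def_def by (simp_all del: One_nat_def)
  hence ac: "a > 0" "c > 0" by (simp_all add: bqf_def)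
  have disc: "b\<^sup>2 < 4 * a * c"
    using bqf_pos_def_disc_neg[OF assms(1)] by (simp add: bqf_disc_def)
  define s where "s = sqrt (4 * a * c - b\<^sup>2)"
  have spos: "s > 0" using disc by (simp add: s_def)
  have s: "sqrt \<bar>d\<bar> = s" using disc by (simp add: assms(2) bqf_disc_def s_def)
  define K where "K = 2 * pi / s * euler_mascheroni - pi\<^sup>2 / 6 * (1 / a + 1 / c)
     - 4 * pi / s * ln (cmod (dedekind_eta (bqf_mu a b c)))
      + 1 / s * ((pi / 2 - arctan ((c - a) / s)) * ln (c / a) - bqf_clausen a b c)"
  define p where "p = 1 / (a - b + c) + 1 / (a + b + c)"
  define r where "r = 1 / a + 1 / c"
  \<comment> \<open>The coefficients come from summing the increment. Those of pi / s belong to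
    H_(n-1) - log n - \<gamma> = -1/(2 n) - 1/(12 n^2) + ..., multiplied by 2 pi / s; those of r to
    the tail of the sum of 1/k^2 over k \<ge> n; those of p to one sixth of the tail of the sum of
    1/k^3.\<close>
  define U where "U = (\<lambda>x. (r - pi / s) * (1 / x) + (1 / 2 * r + 1 / 12 * p - pi / (6 * s)) * (1 / x ^ 2)
       + (1 / 6 * r + 1 / 12 * p) * (1 / x ^ 3))"
  define X where "X = (\<lambda>n. bqf_sum a b c n - 2 * pi / s * ln (real n) - U (real n))"
  have "X \<longlonglongrightarrow> K - 0"
    unfolding X_def
  proof (rule tendsto_diff)
    show "(\<lambda>n. bqf_sum a b c n - 2 * pi / s * ln (real n)) \<longlonglongrightarrow> K"
      unfolding K_def s_def using ac disc by (intro bqf_sum_limit)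
    show "(\<lambda>n. U (real n)) \<longlonglongrightarrow> 0"
      unfolding U_def by real_asymp
  qed
  hence "X \<longlonglongrightarrow> K" by simp
  moreover have "(\<lambda>n. X (Suc n) - X n) \<in> O(\<lambda>n. 1 / real n ^ 5)"
  proof -
    define I where "I = (\<lambda>n. bqf_sum a b c (Suc n) - bqf_sum a b c n
      - (2 * pi / s * (1 / real n) - r * (1 / real n ^ 2) - p / 6 * (1 / real n ^ 3)))"
    \<comment> \<open>The increment of X is linear in 2 pi / s, r and p. Separating these leaves
      three functions of n without parameters, whose expansions cancel up to order n^(-4).\<close>
    define f1 :: "nat \<Rightarrow> real" where "f1 = (\<lambda>n. 1 / real n - (ln (real n + 1) - ln (real n)) + 1 / 2 * (1 / (real n + 1) - 1 / real n)
        + 1 / 12 * (1 / (real n + 1) ^ 2 - 1 / real n ^ 2))"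
    define f2 :: "nat \<Rightarrow> real" where "f2 = (\<lambda>n. 1 / real n ^ 2 + (1 / (real n + 1) - 1 / real n) + 1 / 2 * (1 / (real n + 1) ^ 2 - 1 / real n ^ 2)
        + 1 / 6 * (1 / (real n + 1) ^ 3 - 1 / real n ^ 3))"
    define f3 :: "nat \<Rightarrow> real" where "f3 = (\<lambda>n. 1 / 6 * (1 / real n ^ 3) + 1 / 12 * (1 / (real n + 1) ^ 2 - 1 / real n ^ 2)
        + 1 / 12 * (1 / (real n + 1) ^ 3 - 1 / real n ^ 3))"
    have I: "I \<in> O(\<lambda>n. 1 / real n ^ 5)"
      using bqf_sum_increment[of a c b] ac disc
      by (simp add: I_def r_def[symmetric] p_def[symmetric] s_def[symmetric])
    have f: "f1 \<in> O(\<lambda>n. 1 / real n ^ 5)" "f2 \<in> O(\<lambda>n. 1 / real n ^ 5)" "f3 \<in> O(\<lambda>n. 1 / real n ^ 5)"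
      unfolding f1_def f2_def f3_def by real_asymp+
    have "X (Suc n) - X n = I n + 2 * pi / s * f1 n - r * f2 n - p * f3 n" for n
    proof -
      have Suc: "real (Suc n) = real n + 1" by simp
      \<comment> \<open>Logarithms and inverse powers are replaced by free variables, which reduces
        the decomposition to an algebraic identity.\<close>
      have "(g' - 2 * pi / s * l' - ((r - pi / s) * v1 + (1 / 2 * r + 1 / 12 * p - pi / (6 * s)) * v2 + (1 / 6 * r + 1 / 12 * p) * v3))
          - (g - 2 * pi / s * l - ((r - pi / s) * u1 + (1 / 2 * r + 1 / 12 * p - pi / (6 * s)) * u2 + (1 / 6 * r + 1 / 12 * p) * u3))
        = (g' - g - (2 * pi / s * u1 - r * u2 - p / 6 * u3))
          + 2 * pi / s * (u1 - (l' - l) + 1 / 2 * (v1 - u1) + 1 / 12 * (v2 - u2))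
          - r * (u2 + (v1 - u1) + 1 / 2 * (v2 - u2) + 1 / 6 * (v3 - u3))
          - p * (1 / 6 * u3 + 1 / 12 * (v2 - u2) + 1 / 12 * (v3 - u3))" for g g' l l' u1 u2 u3 v1 v2 v3 :: real
        using spos by (simp add: field_simps)
      thus ?thesis
        unfolding X_def I_def f1_def f2_def f3_def U_def Suc by this
    qed
    moreover have "(\<lambda>n. I n + 2 * pi / s * f1 n - r * f2 n - p * f3 n) \<in> O(\<lambda>n. 1 / real n ^ 5)"
    proof -
      have cmult: "(\<lambda>n. k * f n) \<in> O(\<lambda>n. 1 / real n ^ 5)" if "f \<in> O(\<lambda>n. 1 / real n ^ 5)" for k and f :: "nat \<Rightarrow> real"
        using that by (cases "k = 0") auto
      show ?thesis by (intro sum_in_bigo I cmult f)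
    qed
    ultimately show ?thesis by simp
  qed
  ultimately have "(\<lambda>n. X n - K) \<in> O(\<lambda>n. 1 / real n ^ 4)"
    by (rule bigo_limit_from_increments)
  also have "(\<lambda>n. 1 / real n ^ 4) \<in> O(\<lambda>n. ln (real n) / real n ^ 4)"
    by real_asymp
  finally show ?thesis
    unfolding s by (simp add: X_def U_def K_def r_def p_def algebra_simps)
qed

end
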